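(* Let $N\ge 3$, $-2<\alpha\le 0$, $p>1$, $\sigma>-1$, $m\in\mathbb{R}$, let $\mathbf{w}\in C_B(\mathbb{R}^N)$, and let $\zeta:(0,\infty)\to(0,\infty)$ be given either by $\zeta(t)=t^\sigma$ for all $t>0$, or by $\zeta(t)=t^\sigma$ for $0<t<1$ and $\zeta(t)=t^m$ for $t\ge 1$. Then for every $u_0\in C_B(\mathbb{R}^N)$ the Cauchy problem $$u_t-\Delta u=|x|^\alpha|u|^p+\zeta(t)\,\mathbf{w}(x)\ \text{ in }(0,\infty)\times\mathbb{R}^N,\qquad u(0,x)=u_0(x)\ \text{ in }\mathbb{R}^N,$$ has a unique maximal $C_B$-mild solution $u$ on $[0,T^* )\times\mathbb{R}^N$, with $0<T^*\le\infty$, such that if $T^*<\infty$, then $\lim_{t\to T^*}\|u(t)\|_{L^\infty(\mathbb{R}^N)}=\infty$. Furthermore, if $u_0\ge 0$ and $\mathbf{w}\ge 0$, then $u$ is nonnegative.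
   Context: $C_B(\mathbb{R}^N)=C(\mathbb{R}^N)\cap L^\infty(\mathbb{R}^N)$ is the space of bounded continuous real-valued functions, with the sup norm, and $C_B([0,T]\times\mathbb{R}^N)$ is defined similarly. The heat semigroup is $e^{t\Delta}\varphi=G_t\star\varphi$ for $t>0$, with $G_t(x)=(4\pi t)^{-N/2}e^{-|x|^2/(4t)}$, and $e^{0\Delta}$ is the identity. A $C_B$-mild solution on $[0,T^* )\times\mathbb{R}^N$ is a function $u$ which belongs to $C_B([0,T]\times\mathbb{R}^N)$ for every $0<T<T^*$ and satisfies, for all $t\in[0,T^* )$, $$u(t)=e^{t\Delta}u_0+\int_0^t e^{(t-\tau)\Delta}\left(|\cdot|^\alpha|u(\tau)|^p\right)d\tau+\int_0^t e^{(t-\tau)\Delta}\left(\zeta(\tau)\mathbf{w}\right)d\tau .$$ It is maximal if it cannot be extended to a $C_B$-mild solution on a strictly larger time interval. *)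

theory Defs
  imports "HOL-Analysis.Analysis"
begin

definition heat_kernel :: "real \<Rightarrow> real ^ 'n \<Rightarrow> real" where
  "heat_kernel t x =
     (4 * pi * t) powr (- real CARD('n) / 2) * exp (- (norm x)\<^sup>2 / (4 * t))"

definition heat_semigroup :: "real \<Rightarrow> (real ^ 'n \<Rightarrow> real) \<Rightarrow> real ^ 'n \<Rightarrow> real" where
  "heat_semigroup t \<phi> x =
     (if t = 0 then \<phi> x else (LINT y|lborel. heat_kernel t (x - y) * \<phi> y))"

text \<open>
  Mild solutions on the time interval \<open>[0, Tmax)\<close>, where \<open>Tmax\<close> may be \<open>\<infinity>\<close>; only the values of
  \<open>u t\<close> for \<open>0 \<le> t < Tmax\<close> matter.  The equation is an identity between functions of \<open>x\<close>,
  and the time integrals are Lebesgue integrals taken pointwise in \<open>x\<close>.  When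
  \<open>- CARD('n) < \<alpha> \<le> 0\<close>, \<open>\<alpha> > - 2\<close>, \<open>p > 0\<close>, \<open>\<zeta>\<close> is measurable and integrable on bounded
  intervals \<open>(0, t)\<close>, \<open>w\<close> is bounded and continuous, and \<open>u\<close> satisfies the first condition, all
  of these integrals converge absolutely, so the default value 0 of a non-convergent integral
  does not enter.  The convention \<open>0 powr \<alpha> = 0\<close> affects the weight only at the null
  set \<open>{0}\<close>, hence not the integrals.
\<close>

definition mild_solution ::
  "real \<Rightarrow> real \<Rightarrow> (real \<Rightarrow> real) \<Rightarrow> (real ^ 'n \<Rightarrow> real) \<Rightarrow> (real ^ 'n \<Rightarrow> real)
     \<Rightarrow> ereal \<Rightarrow> (real \<Rightarrow> real ^ 'n \<Rightarrow> real) \<Rightarrow> bool" where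
  "mild_solution \<alpha> p \<zeta> w u0 Tmax u \<longleftrightarrow>
     0 < Tmax \<and>
     (\<forall>T. 0 < T \<and> ereal T < Tmax \<longrightarrow>
        continuous_on ({0..T} \<times> UNIV) (\<lambda>(t, x). u t x) \<and>
        bounded ((\<lambda>(t, x). u t x) ` ({0..T} \<times> UNIV))) \<and>
     (\<forall>t x. 0 \<le> t \<and> ereal t < Tmax \<longrightarrow>
        u t x =
          heat_semigroup t u0 x
          + (LBINT \<tau>:{0<..<t}.
               heat_semigroup (t - \<tau>) (\<lambda>y. norm y powr \<alpha> * \<bar>u \<tau> y\<bar> powr p) x)
          + (LBINT \<tau>:{0<..<t}. heat_semigroup (t - \<tau>) (\<lambda>y. \<zeta> \<tau> * w y) x))"

definition maximal_mild_solution ::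
  "real \<Rightarrow> real \<Rightarrow> (real \<Rightarrow> real) \<Rightarrow> (real ^ 'n \<Rightarrow> real) \<Rightarrow> (real ^ 'n \<Rightarrow> real)
     \<Rightarrow> ereal \<Rightarrow> (real \<Rightarrow> real ^ 'n \<Rightarrow> real) \<Rightarrow> bool" where
  "maximal_mild_solution \<alpha> p \<zeta> w u0 Tmax u \<longleftrightarrow>
     mild_solution \<alpha> p \<zeta> w u0 Tmax u \<and>
     \<not> (\<exists>T' v. Tmax < T' \<and> mild_solution \<alpha> p \<zeta> w u0 T' v \<and>
           (\<forall>t x. 0 \<le> t \<and> ereal t < Tmax \<longrightarrow> v t x = u t x))"

end

(*
  Write the weight as W(y) = |y|^\<alpha>.  Since |y| \<ge> |y_i| for every coordinate, W is bounded near the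
  origin by the product of the functions |y_i|^(\<alpha>/N), each locally integrable because \<alpha> > -N; by scaling,
  e^(t\<Delta>) W \<le> C t^(\<alpha>/2), and this is integrable in time because \<alpha> > -2.  The right hand side of the
  Duhamel formula is therefore a contraction, on a time interval whose length depends only on bounds of
  the initial value and of the forcing.  The semigroup law e^(s\<Delta>) e^(t\<Delta>) = e^((s+t)\<Delta>), which comes from
  completing the square in the product of two Gaussians, allows a solution to be restarted at any time.
  Let Tmax be the supremum of all existence times.  If u(t) stayed bounded along a sequence t \<rightarrow> Tmax < \<infinity>,
  restarting close to Tmax would produce a solution living past Tmax.
*)

theory Submission
  imports Defs "HOL-Probability.Distributions"
begin

section \<open>The heat kernel\<close>

text \<open>The two integral terms are singular in different ways, and this shapes the estimates.
  The weight is unbounded and discontinuous in space, while \<open>\<zeta>\<close> is only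
  integrable in time, with a singularity at 0 when \<sigma> < 0. The nonlinear integral is reflected
  to s = t - \<tau>, so that a multiple of s^k, k = \<alpha>/2, dominates it for all t and x. The
  forcing integral is left unreflected, so that a multiple of |\<zeta>| dominates it and no
  continuity of \<open>\<zeta>\<close> enters. On C_B the semigroup is not strongly continuous at
  time 0 in the sup norm; continuity of solutions is therefore proved jointly in (t, x), by
  dominated convergence along sequences. A restart at time r replaces \<open>\<zeta>\<close> by its
  translate, which is no longer a power. Hence the theory treats any \<open>\<zeta>\<close>
  integrable on all (0, T), and the local existence time depends on \<open>\<zeta>\<close> only
  through a bound for the integral of |\<zeta>| over (0, 1). For the translates these integrals stay
  bounded as r ranges over a bounded interval, which makes the restart length uniform near a finite
  Tmax.\<close>

lemma borel_measurable_heat_kernel [measurable]: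
  assumes [measurable]: "f \<in> borel_measurable M" "g \<in> borel_measurable M"
  shows "(\<lambda>z. heat_kernel (f z) (g z)) \<in> borel_measurable M"
  unfolding heat_kernel_def by measurable

lemma heat_kernel_nonneg [simp]: "0 \<le> heat_kernel t x"
  by (simp add: heat_kernel_def)

text \<open>Each coordinate is a centred normal variable of variance \<open>2 * t\<close>; the total
  mass 1 of the kernel then comes from the one-dimensional density.\<close>

lemma heat_kernel_eq_prod_normal_density:
  fixes x :: "real ^ 'n"
  assumes "0 < t"
  shows "heat_kernel t x = (\<Prod>b\<in>Basis. normal_density 0 (sqrt (2 * t)) (x \<bullet> b))"
proof -
  have "(\<Prod>b\<in>Basis. normal_density 0 (sqrt (2 * t)) (x \<bullet> b))
      = (1 / sqrt (4 * pi * t)) ^ CARD('n) * exp (\<Sum>b\<in>Basis. - (x \<bullet> b)\<^sup>2 / (4 * t))"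
    using assms by (simp add: normal_density_def prod_dividef power_one_over exp_sum mult_ac)
  also have "(\<Sum>b\<in>Basis. - (x \<bullet> b)\<^sup>2 / (4 * t)) = - (norm x)\<^sup>2 / (4 * t)"
    unfolding power2_norm_eq_inner
    by (subst euclidean_inner) (simp add: sum_negf sum_divide_distrib[symmetric] power2_eq_square)
  also have "(1 / sqrt (4 * pi * t)) ^ CARD('n) = (4 * pi * t) powr (- real CARD('n) / 2)"
    using assms
    by (simp add: powr_minus_divide powr_half_sqrt[symmetric] powr_powr powr_realpow[symmetric]
        power_one_over)
  finally show ?thesis
    by (simp add: heat_kernel_def)
qed

lemma has_bochner_integral_heat_kernel_0:
  assumes "0 < t"
  shows "has_bochner_integral lborel (heat_kernel t :: real ^ 'n \<Rightarrow> real) 1"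
proof (rule has_bochner_integral_nn_integral)
  have "(\<integral>\<^sup>+ x. ennreal (heat_kernel t (x :: real ^ 'n)) \<partial>lborel)
      = (\<integral>\<^sup>+ x. (\<Prod>b\<in>Basis. ennreal (normal_density 0 (sqrt (2 * t)) ((x :: real ^ 'n) \<bullet> b))) \<partial>lborel)"
    using assms by (simp add: heat_kernel_eq_prod_normal_density prod_ennreal)
  also have "\<dots> = (\<Prod>b\<in>(Basis :: (real^'n) set). \<integral>\<^sup>+ x. ennreal (normal_density 0 (sqrt (2 * t)) x) \<partial>lborel)"
    by (rule nn_integral_lborel_prod) auto
  also have "\<dots> = 1"
    using assms prob_space.emeasure_space_1[OF prob_space_normal_density[of "sqrt (2 * t)" 0]]
    by (simp add: emeasure_density)
  finally show "(\<integral>\<^sup>+ x. ennreal (heat_kernel t (x :: real ^ 'n)) \<partial>lborel) = ennreal 1" by simp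
qed auto

lemma nn_integral_lborel_affine:
  fixes f :: "'a :: euclidean_space \<Rightarrow> ennreal"
  assumes [measurable]: "f \<in> borel_measurable borel" and "c \<noteq> 0"
  shows "(\<integral>\<^sup>+ x. f x \<partial>lborel) = ennreal (\<bar>c\<bar> ^ DIM('a)) * (\<integral>\<^sup>+ x. f (a + c *\<^sub>R x) \<partial>lborel)"
  using assms(2) by (subst lborel_affine[of c a])
    (simp_all add: nn_integral_density nn_integral_distr nn_integral_cmult)

lemma lborel_integral_affine:
  fixes f :: "'a :: euclidean_space \<Rightarrow> real"
  assumes [measurable]: "f \<in> borel_measurable borel" and "c \<noteq> 0"
  shows "(LINT x|lborel. f x) = \<bar>c\<bar> ^ DIM('a) * (LINT x|lborel. f (a + c *\<^sub>R x))"
  using assms(2) by (subst lborel_affine[of c a])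
    (simp_all add: integral_density integral_distr)

lemma lborel_integrable_affine:
  fixes f :: "'a :: euclidean_space \<Rightarrow> real"
  assumes [measurable]: "f \<in> borel_measurable borel" and "c \<noteq> 0"
  shows "integrable lborel (\<lambda>x. f (a + c *\<^sub>R x)) \<longleftrightarrow> integrable lborel f"
  using assms(2) nn_integral_lborel_affine[of "\<lambda>x. ennreal (norm (f x))" c a]
  by (auto simp: integrable_iff_bounded ennreal_mult_less_top ennreal_mult_eq_top_iff less_top)

lemma heat_kernel_scale:
  fixes z :: "real ^ 'n"
  assumes "0 < t"
  shows "sqrt t ^ CARD('n) * heat_kernel t (sqrt t *\<^sub>R z) = heat_kernel 1 z"
proof -
  have "sqrt t ^ CARD('n) * (4 * pi * t) powr (- real CARD('n) / 2) = (4 * pi) powr (- real CARD('n) / 2)"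
    using assms by (simp add: powr_mult powr_minus_divide powr_half_sqrt[symmetric] powr_powr powr_realpow[symmetric])
  then show ?thesis
    using assms by (simp add: heat_kernel_def power_mult_distrib mult.assoc[symmetric])
qed

lemma heat_kernel_minus: "heat_kernel t (- x) = heat_kernel t x"
  by (simp add: heat_kernel_def)

text \<open>Substitute y = x + sqrt t z: the Jacobian is absorbed by parabolic scaling, and the sign
  of z disappears because the kernel is even. All later questions about small t are thereby moved
  from the kernel to the argument of \<open>\<phi>\<close>.\<close>

lemma heat_integral_scale:
  fixes x :: "real ^ 'n"
  assumes [measurable]: "\<phi> \<in> borel_measurable borel" and t: "0 < t"
  shows "(LINT y|lborel. heat_kernel t (x - y) * \<phi> y) = (LINT z|lborel. heat_kernel 1 z * \<phi> (x + sqrt t *\<^sub>R z))"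
    and "integrable lborel (\<lambda>y. heat_kernel t (x - y) * \<phi> y)
      \<longleftrightarrow> integrable lborel (\<lambda>z. heat_kernel 1 z * \<phi> (x + sqrt t *\<^sub>R z))"
proof -
  have s: "sqrt t \<noteq> 0" using t by simp
  have *: "\<bar>sqrt t\<bar> ^ CARD('n) * (heat_kernel t (x - (x + sqrt t *\<^sub>R z)) * \<phi> (x + sqrt t *\<^sub>R z))
     = heat_kernel 1 z * \<phi> (x + sqrt t *\<^sub>R z)" for z
    using t by (simp add: heat_kernel_scale[symmetric] heat_kernel_minus)
  show "(LINT y|lborel. heat_kernel t (x - y) * \<phi> y) = (LINT z|lborel. heat_kernel 1 z * \<phi> (x + sqrt t *\<^sub>R z))"
    using lborel_integral_affine[OF _ s, of "\<lambda>y. heat_kernel t (x - y) * \<phi> y" x]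
    by (simp add: *[symmetric])
  show "integrable lborel (\<lambda>y. heat_kernel t (x - y) * \<phi> y)
      \<longleftrightarrow> integrable lborel (\<lambda>z. heat_kernel 1 z * \<phi> (x + sqrt t *\<^sub>R z))"
    using lborel_integrable_affine[OF _ s, of "\<lambda>y. heat_kernel t (x - y) * \<phi> y" x] t
    unfolding *[symmetric] by simp
qed

lemma heat_kernel_integral:
  fixes x :: "real ^ 'n"
  assumes "0 < t"
  shows "integrable lborel (\<lambda>y. heat_kernel t (x - y))" "(LINT y|lborel. heat_kernel t (x - y)) = 1"
  using heat_integral_scale[OF borel_measurable_const[of "1::real"] assms, of x] assms
    has_bochner_integral_heat_kernel_0[OF zero_less_one, where 'n='n]
  by (simp_all add: has_bochner_integral_iff)

text \<open>As a function of \<open>y\<close> the product is one Gaussian, centred at the weighted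
  mean of \<open>x\<close> and \<open>z\<close> with time \<open>s * t / (s + t)\<close>. All
  dependence on \<open>y\<close> sits in the last factor, which has mass 1, so the convolution
  formula is immediate.\<close>

lemma heat_kernel_mult:
  fixes x y z :: "real ^ 'n"
  assumes s: "0 < s" and t: "0 < t"
  shows "heat_kernel s (x - y) * heat_kernel t (y - z)
     = heat_kernel (s + t) (x - z) * heat_kernel (s * t / (s + t)) ((t / (s + t)) *\<^sub>R x + (s / (s + t)) *\<^sub>R z - y)"
proof -
  have st: "s + t \<noteq> 0" using s t by simp
  have "(norm (x - y))\<^sup>2 / (4 * s) + (norm (y - z))\<^sup>2 / (4 * t)
    = (norm (x - z))\<^sup>2 / (4 * (s + t)) + (norm ((t / (s + t)) *\<^sub>R x + (s / (s + t)) *\<^sub>R z - y))\<^sup>2 / (4 * (s * t / (s + t)))"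
  proof -
    define a b where "a = x - y" and "b = y - z"
    have xz: "x - z = a + b" by (simp add: a_def b_def)
    have "(t / (s + t)) *\<^sub>R x + (s / (s + t)) *\<^sub>R z - y = (t / (s + t)) *\<^sub>R x + (s / (s + t)) *\<^sub>R z - ((t / (s + t)) + (s / (s + t))) *\<^sub>R y"
      using st by (simp add: add_divide_distrib[symmetric] add.commute)
    also have "\<dots> = (t / (s + t)) *\<^sub>R a - (s / (s + t)) *\<^sub>R b"
      by (simp add: a_def b_def algebra_simps)
    finally have c: "(t / (s + t)) *\<^sub>R x + (s / (s + t)) *\<^sub>R z - y = (1 / (s + t)) *\<^sub>R (t *\<^sub>R a - s *\<^sub>R b)"
      by (simp add: scaleR_diff_right)
    have v: "(norm ((1 / (s + t)) *\<^sub>R (t *\<^sub>R a - s *\<^sub>R b)))\<^sup>2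
      = (t * t * (a \<bullet> a) + s * s * (b \<bullet> b) - 2 * s * t * (a \<bullet> b)) / (s + t)\<^sup>2"
    proof -
      have "b \<bullet> a = a \<bullet> b" by (rule inner_commute)
      then have "(t *\<^sub>R a - s *\<^sub>R b) \<bullet> (t *\<^sub>R a - s *\<^sub>R b)
        = t * t * (a \<bullet> a) + s * s * (b \<bullet> b) - 2 * s * t * (a \<bullet> b)"
        by (simp add: inner_diff_left inner_diff_right right_diff_distrib)
      moreover have "(norm ((1 / (s + t)) *\<^sub>R u))\<^sup>2 = u \<bullet> u / (s + t)\<^sup>2" for u :: "real ^ 'n"
        by (simp add: power_mult_distrib power2_norm_eq_inner power_divide)
      ultimately show ?thesis by (simp only:)
    qed
    have "(norm a)\<^sup>2 / (4 * s) + (norm b)\<^sup>2 / (4 * t)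
      = (norm (a + b))\<^sup>2 / (4 * (s + t)) + (norm ((1 / (s + t)) *\<^sub>R (t *\<^sub>R a - s *\<^sub>R b)))\<^sup>2 / (4 * (s * t / (s + t)))"
    proof -
      define A B e where "A = a \<bullet> a" and "B = b \<bullet> b" and "e = a \<bullet> b"
      define n where "n = s + t"
      have n: "n \<noteq> 0" "s \<noteq> 0" "t \<noteq> 0" using s t by (auto simp: n_def)
      \<comment> \<open>The claim over the common denominator \<open>4 * s * t * n\<close>: the two
        mixed terms in \<open>e\<close> cancel, and \<open>s * t + t * t = t * n\<close> together
        with \<open>s * t + s * s = s * n\<close> gives the rest.\<close>
      have "(t * A + s * B) * n = (A + B + 2 * e) * (s * t) + (t * t * A + s * s * B - 2 * s * t * e)"
        by (simp add: n_def algebra_simps)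
      then have "(t * A + s * B) * n / (4 * s * t * n)
          = (A + B + 2 * e) * (s * t) / (4 * s * t * n) + (t * t * A + s * s * B - 2 * s * t * e) / (4 * s * t * n)"
        by (simp only: add_divide_distrib[symmetric])
      moreover have "(t * A + s * B) * n / (4 * s * t * n) = A / (4 * s) + B / (4 * t)"
        using n by (simp add: add_divide_distrib)
      moreover have "(A + B + 2 * e) * (s * t) / (4 * s * t * n) = (A + B + 2 * e) / (4 * n)"
        using n by simp
      moreover have "X / n\<^sup>2 / (4 * (s * t / n)) = X / (4 * s * t * n)" for X
        using n by (simp add: power2_eq_square)
      moreover have "(norm (a + b))\<^sup>2 = A + B + 2 * e"
        by (simp add: A_def B_def e_def power2_norm_eq_inner inner_add_left inner_add_right inner_commute[of b a])
      ultimately show ?thesis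
        unfolding v by (simp only: power2_norm_eq_inner A_def[symmetric] B_def[symmetric] e_def[symmetric] n_def[symmetric])
    qed
    then show ?thesis by (simp only: xz c a_def[symmetric] b_def[symmetric])
  qed
  then have e: "exp (- (norm (x - y))\<^sup>2 / (4 * s)) * exp (- (norm (y - z))\<^sup>2 / (4 * t))
    = exp (- (norm (x - z))\<^sup>2 / (4 * (s + t))) * exp (- (norm ((t / (s + t)) *\<^sub>R x + (s / (s + t)) *\<^sub>R z - y))\<^sup>2 / (4 * (s * t / (s + t))))"
    by (simp add: exp_add[symmetric] del: times_divide_eq_right)
  have "(4 * pi * s) * (4 * pi * t) = (4 * pi * (s + t)) * (4 * pi * (s * t / (s + t)))"
    using st by (simp add: field_simps)
  then have "(4 * pi * s) powr q * (4 * pi * t) powr q = (4 * pi * (s + t)) powr q * (4 * pi * (s * t / (s + t))) powr q" for q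
    using s t by (simp only: powr_mult[symmetric])
  note p = this
  have "P * E * (P' * E') = Q * F * (Q' * F')" if "P * P' = Q * Q'" "E * E' = F * F'" for P E P' E' Q F Q' F' :: real
  proof -
    have "P * E * (P' * E') = (P * P') * (E * E')" by simp
    then show ?thesis using that by simp
  qed
  from this[OF p e] show ?thesis
    unfolding heat_kernel_def .
qed

lemma heat_kernel_convolution:
  fixes x z :: "real ^ 'n"
  assumes "0 < s" "0 < t"
  shows "(LINT y|lborel. heat_kernel s (x - y) * heat_kernel t (y - z)) = heat_kernel (s + t) (x - z)"
    and "integrable lborel (\<lambda>y. heat_kernel s (x - y) * heat_kernel t (y - z))"
proof -
  have "0 < s * t / (s + t)" using assms by simp
  note i = heat_kernel_integral[OF this]
  show "(LINT y|lborel. heat_kernel s (x - y) * heat_kernel t (y - z)) = heat_kernel (s + t) (x - z)"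
    by (simp add: heat_kernel_mult[OF assms] i)
  show "integrable lborel (\<lambda>y. heat_kernel s (x - y) * heat_kernel t (y - z))"
    by (simp add: heat_kernel_mult[OF assms] i)
qed

section \<open>The singular weight under the heat semigroup\<close>

lemma nn_integral_le_imp_integrable:
  fixes f :: "'a \<Rightarrow> real"
  assumes [measurable]: "f \<in> borel_measurable M" and "\<And>x. 0 \<le> f x" "0 \<le> c"
    and le: "(\<integral>\<^sup>+ x. ennreal (f x) \<partial>M) \<le> ennreal c"
  shows "integrable M f" "integral\<^sup>L M f \<le> c"
proof -
  show "integrable M f"
    using le assms(2) by (intro integrableI_bounded) (auto simp: order_le_less_trans)
  show "integral\<^sup>L M f \<le> c"
    using assms(3) le by (rule integral_real_bounded)
qed

lemma set_integral_powr_Ioo: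
  fixes k t :: real
  assumes k: "- 1 < k" and t: "0 \<le> t"
  shows "set_integrable lborel {0<..<t} (\<lambda>s. s powr k)"
    and "(LBINT s:{0<..<t}. s powr k) = t powr (k + 1) / (k + 1)"
proof -
  have 1: "((\<lambda>s. s powr k) has_integral t powr (k + 1) / (k + 1)) {0..t}"
    using has_integral_powr_from_0[OF k t] .
  then have 2: "((\<lambda>s. s powr k) has_integral t powr (k + 1) / (k + 1)) {0<..<t}"
    using has_integral_Icc_iff_Ioo by blast
  then have "(\<lambda>s. s powr k) absolutely_integrable_on {0<..<t}"
    by (intro nonnegative_absolutely_integrable_1) (auto simp: has_integral_integrable)
  then show 3: "set_integrable lborel {0<..<t} (\<lambda>s. s powr k)"
    unfolding set_integrable_def by (subst (asm) integrable_completion) auto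
  show "(LBINT s:{0<..<t}. s powr k) = t powr (k + 1) / (k + 1)"
    using set_borel_integral_eq_integral(2)[OF 3] 2 by (simp add: integral_unique)
qed

lemma nn_integral_powr_cube_finite:
  fixes k :: real
  assumes k: "- 1 < k"
  shows "(\<integral>\<^sup>+ s. ennreal (indicator {-1..1} s * \<bar>s\<bar> powr k) \<partial>lborel) < \<infinity>"
proof -
  let ?f = "\<lambda>s::real. indicator {0<..<1} s * s powr k"
  have "integrable lborel ?f"
    using set_integral_powr_Ioo(1)[OF k, of 1] by (simp add: set_integrable_def)
  then have fin: "(\<integral>\<^sup>+ s. ennreal (?f s) \<partial>lborel) < \<infinity>"
    by (simp add: integrable_iff_bounded abs_mult)
  have "(\<integral>\<^sup>+ s. ennreal (indicator {-1..1} s * \<bar>s\<bar> powr k) \<partial>lborel)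
     \<le> (\<integral>\<^sup>+ s. ennreal (?f s) + ennreal (?f (- s)) \<partial>lborel)"
  proof (rule nn_integral_mono_AE)
    \<comment> \<open>The open intervals miss the points 1 and -1. At \<open>s = 0\<close> there is
      nothing to prove, because \<open>0 powr k = 0\<close>.\<close>
    show "AE s in lborel. ennreal (indicator {-1..1} s * \<bar>s\<bar> powr k) \<le> ennreal (?f s) + ennreal (?f (- s))"
      using AE_lborel_singleton[of "1::real"] AE_lborel_singleton[of "- 1::real"]
      by eventually_elim (auto simp: indicator_def)
  qed
  also have "\<dots> = (\<integral>\<^sup>+ s. ennreal (?f s) \<partial>lborel) + (\<integral>\<^sup>+ s. ennreal (?f (- s)) \<partial>lborel)"
    by (rule nn_integral_add) auto
  also have "(\<integral>\<^sup>+ s. ennreal (?f (- s)) \<partial>lborel) = (\<integral>\<^sup>+ s. ennreal (?f s) \<partial>lborel)"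
    using nn_integral_real_affine[of "\<lambda>s. ennreal (?f s)" "-1" 0] by simp
  finally show ?thesis
    using fin by (auto intro: order_le_less_trans)
qed

text \<open>The exponent is distributed evenly over the coordinates, and a nonpositive power
  reverses the bound of each coordinate by the norm. A zero coordinate would make the product 0 by
  the convention \<open>0 powr a = 0\<close>, so coordinate hyperplanes are excluded; they are null
  sets.\<close>

lemma norm_powr_le_prod:
  fixes y :: "'a :: euclidean_space"
  assumes "a \<le> 0" "y \<noteq> 0" "\<And>b. b \<in> Basis \<Longrightarrow> y \<bullet> b \<noteq> 0"
  shows "norm y powr a \<le> (\<Prod>b\<in>(Basis :: 'a set). \<bar>y \<bullet> b\<bar> powr (a / DIM('a)))"
proof -
  have "norm y powr a = (\<Prod>b\<in>(Basis :: 'a set). norm y powr (a / DIM('a)))"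
    using assms(2) by (simp add: powr_realpow[symmetric] powr_powr)
  also have "\<dots> \<le> (\<Prod>b\<in>(Basis :: 'a set). \<bar>y \<bullet> b\<bar> powr (a / DIM('a)))"
    using assms by (intro prod_mono) (auto intro!: powr_mono2' Basis_le_norm simp: divide_nonpos_pos)
  finally show ?thesis .
qed

lemma heat_norm_powr_bound:
  fixes a :: real
  assumes a: "a \<le> 0" "- real CARD('n) < a"
  shows "\<exists>C>0. \<forall>t>0. \<forall>x :: real ^ 'n.
    integrable lborel (\<lambda>y. heat_kernel t (x - y) * norm y powr a) \<and>
    (LINT y|lborel. heat_kernel t (x - y) * norm y powr a) \<le> C * t powr (a / 2)"
proof -
  let ?B = "Basis :: (real ^ 'n) set"
  define k where "k = a / CARD('n)"
  have k: "- 1 < k" using a(2) by (simp add: k_def field_simps)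
  \<comment> \<open>The product bound cut off to the cube [-1, 1]^N, where it is integrable. Outside
    the unit ball the weight is at most 1, so \<open>1 + V\<close> dominates it almost
    everywhere.\<close>
  define V where "V y = (\<Prod>b\<in>?B. indicator {-1..1} (y \<bullet> b) * \<bar>y \<bullet> b\<bar> powr k)" for y
  have Vm [measurable]: "V \<in> borel_measurable borel" unfolding V_def by measurable
  have V0: "0 \<le> V y" for y by (auto simp: V_def intro!: prod_nonneg)
  have "(\<integral>\<^sup>+ y. ennreal (V y) \<partial>lborel) = (\<integral>\<^sup>+ y. (\<Prod>b\<in>?B. ennreal (indicator {-1..1} (y \<bullet> b) * \<bar>y \<bullet> b\<bar> powr k)) \<partial>lborel)"
    by (simp add: V_def prod_ennreal)
  also have "\<dots> = (\<Prod>b\<in>?B. \<integral>\<^sup>+ s. ennreal (indicator {-1..1} s * \<bar>s\<bar> powr k) \<partial>lborel)"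
    by (rule nn_integral_lborel_prod) auto
  also have "\<dots> < \<infinity>"
    using nn_integral_powr_cube_finite[OF k] by (simp add: power_less_top_ennreal)
  finally obtain A where A: "0 \<le> A" "(\<integral>\<^sup>+ y. ennreal (V y) \<partial>lborel) = ennreal A"
    by (cases "\<integral>\<^sup>+ y. ennreal (V y) \<partial>lborel") auto
  have ae: "AE y in lborel. norm y powr a \<le> 1 + V y"
  proof -
    have "AE y in lborel. \<forall>b\<in>?B. y \<bullet> b \<noteq> 0"
    proof (subst AE_finite_all)
      show "finite ?B" by simp
      show "\<forall>b\<in>?B. AE y in lborel. y \<bullet> b \<noteq> 0"
      proof
        fix b assume b: "b \<in> ?B"
        have "negligible {y. b \<bullet> y = 0}"
          using b by (intro negligible_hyperplane) auto
        then have "{y. b \<bullet> y = 0} \<in> null_sets lebesgue"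
          by (simp add: negligible_iff_null_sets)
        then have "{y. b \<bullet> y = 0} \<in> null_sets lborel"
          by (subst (asm) null_sets_completion_iff) (simp_all add: closed_hyperplane borel_closed)
        from AE_not_in[OF this] show "AE y in lborel. y \<bullet> b \<noteq> 0"
          by (simp add: inner_commute)
      qed
    qed
    then show ?thesis
    proof eventually_elim
      fix y :: "real ^ 'n" assume y: "\<forall>b\<in>?B. y \<bullet> b \<noteq> 0"
      then have y0: "y \<noteq> 0" using nonempty_Basis by force
      show "norm y powr a \<le> 1 + V y"
      proof (cases "norm y \<le> 1")
        case True
        then have "\<bar>y \<bullet> b\<bar> \<le> 1" if "b \<in> ?B" for b
          using Basis_le_norm[OF that, of y] by simp
        then have "V y = (\<Prod>b\<in>?B. \<bar>y \<bullet> b\<bar> powr k)"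
          unfolding V_def by (intro prod.cong) (auto simp: indicator_def abs_le_iff)
        then show ?thesis
          using norm_powr_le_prod[OF a(1) y0] y by (simp add: k_def)
      next
        case False
        then have "norm y powr a \<le> 1 powr a"
          using a by (intro powr_mono2') auto
        then show ?thesis using V0[of y] by simp
      qed
    qed
  qed
  \<comment> \<open>Uniform in the translation \<open>x\<close>: the constant 1 is integrated
    against the mass of the kernel, while for \<open>V\<close> the kernel at time 1 is bounded by 1
    and the integral \<open>A\<close> of \<open>V\<close> is translation invariant.\<close>
  have one: "integrable lborel (\<lambda>z. heat_kernel 1 z * norm (x + z) powr a)"
    "(LINT z|lborel. heat_kernel 1 z * norm (x + z) powr a) \<le> 1 + A" for x :: "real ^ 'n"
  proof -
    have K1: "heat_kernel 1 z \<le> 1" for z :: "real ^ 'n"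
    proof -
      have "(4 * pi) powr (- real CARD('n) / 2) \<le> 1 powr (- real CARD('n) / 2)"
        using pi_gt3 by (intro powr_mono2') auto
      then show ?thesis
        unfolding heat_kernel_def by (intro mult_le_one) auto
    qed
    have ae': "AE z in lborel. norm (x + z) powr a \<le> 1 + V (x + z)"
    proof -
      have "distr lborel borel ((+) x) = (lborel :: (real ^ 'n) measure)"
        by (rule lborel_distr_plus)
      then show ?thesis
        using ae by (subst (asm) \<open>distr lborel borel ((+) x) = lborel\<close>[symmetric]) (simp add: AE_distr_iff)
    qed
    have "(\<integral>\<^sup>+ z. ennreal (heat_kernel 1 z * norm (x + z) powr a) \<partial>lborel)
      \<le> (\<integral>\<^sup>+ z. ennreal (heat_kernel 1 z) + ennreal (V (x + z)) \<partial>lborel)"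
    proof (rule nn_integral_mono_AE)
      show "AE z in lborel. ennreal (heat_kernel 1 z * norm (x + z) powr a) \<le> ennreal (heat_kernel 1 z) + ennreal (V (x + z))"
        using ae'
      proof eventually_elim
        fix z assume "norm (x + z) powr a \<le> 1 + V (x + z)"
        then have "heat_kernel 1 z * norm (x + z) powr a \<le> heat_kernel 1 z * (1 + V (x + z))"
          by (intro mult_left_mono) auto
        also have "\<dots> \<le> heat_kernel 1 z + V (x + z)"
          using mult_right_mono[OF K1[of z] V0[of "x + z"]] by (simp add: algebra_simps)
        finally show "ennreal (heat_kernel 1 z * norm (x + z) powr a) \<le> ennreal (heat_kernel 1 z) + ennreal (V (x + z))"
          using V0 by (simp add: ennreal_plus[symmetric] ennreal_leI del: ennreal_plus)
      qed
    qed
    also have "\<dots> = (\<integral>\<^sup>+ z. ennreal (heat_kernel 1 (z :: real ^ 'n)) \<partial>lborel) + (\<integral>\<^sup>+ z. ennreal (V (x + z)) \<partial>lborel)"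
      by (rule nn_integral_add) auto
    also have "(\<integral>\<^sup>+ z. ennreal (V (x + z)) \<partial>lborel) = ennreal A"
      using nn_integral_lborel_affine[of "\<lambda>y. ennreal (V y)" 1 x] A by simp
    also have "(\<integral>\<^sup>+ z. ennreal (heat_kernel 1 (z :: real ^ 'n)) \<partial>lborel) = ennreal 1"
      using has_bochner_integral_heat_kernel_0[OF zero_less_one, where 'n='n]
      by (subst nn_integral_eq_integral) (auto simp: has_bochner_integral_iff)
    finally have le: "(\<integral>\<^sup>+ z. ennreal (heat_kernel 1 z * norm (x + z) powr a) \<partial>lborel) \<le> ennreal (1 + A)"
      using A(1) by (simp add: ennreal_plus)
    show "integrable lborel (\<lambda>z. heat_kernel 1 z * norm (x + z) powr a)"
      "(LINT z|lborel. heat_kernel 1 z * norm (x + z) powr a) \<le> 1 + A"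
      using nn_integral_le_imp_integrable[OF _ _ _ le] A(1) by auto
  qed
  show ?thesis
  proof (intro exI[of _ "1 + A"] conjI allI impI)
    show "0 < 1 + A" using A by simp
    fix t :: real and x :: "real ^ 'n" assume t: "0 < t"
    \<comment> \<open>Homogeneity of the weight produces the factor \<open>t powr (a / 2)\<close>.
      What remains is the case of time 1 with base point x / sqrt t, harmless because the bound
      there is uniform in the base point.\<close>
    have sc: "norm (x + sqrt t *\<^sub>R z) powr a = t powr (a / 2) * norm (x /\<^sub>R sqrt t + z) powr a" for z
    proof -
      have "x + sqrt t *\<^sub>R z = sqrt t *\<^sub>R (x /\<^sub>R sqrt t + z)"
        using t by (simp add: scaleR_add_right)
      then have "norm (x + sqrt t *\<^sub>R z) = sqrt t * norm (x /\<^sub>R sqrt t + z)"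
        using t by simp
      then show ?thesis
        using t by (simp add: powr_mult powr_half_sqrt[symmetric] powr_powr)
    qed
    have eq: "heat_kernel 1 z * norm (x + sqrt t *\<^sub>R z) powr a
      = t powr (a / 2) * (heat_kernel 1 z * norm (x /\<^sub>R sqrt t + z) powr a)" for z
      by (simp add: sc)
    show "integrable lborel (\<lambda>y. heat_kernel t (x - y) * norm y powr a)"
      using t one(1) by (subst heat_integral_scale(2)) (simp_all only: eq, auto)
    show "(LINT y|lborel. heat_kernel t (x - y) * norm y powr a) \<le> (1 + A) * t powr (a / 2)"
      using t one(2)[of "x /\<^sub>R sqrt t"] mult_left_mono[OF one(2)[of "x /\<^sub>R sqrt t"], of "t powr (a / 2)"]
      by (subst heat_integral_scale(1)) (simp_all only: eq, auto simp: mult.commute)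
  qed
qed

text \<open>From |x - y|^2 <= 2 |x' - x|^2 + 2 |x' - y|^2. It dominates the kernels of all base
  points near \<open>x\<close> by one kernel at \<open>x\<close>, at the price of doubling the time,
  whose normalisation accounts for the power of 2.\<close>

lemma heat_kernel_shift_le:
  fixes x x' y :: "real ^ 'n"
  assumes s: "0 < s"
  shows "heat_kernel s (x' - y)
    \<le> 2 powr (real CARD('n) / 2) * exp ((norm (x' - x))\<^sup>2 / (4 * s)) * heat_kernel (2 * s) (x - y)"
proof -
  have "(norm (x - y))\<^sup>2 \<le> (norm (x' - x) + norm (x' - y))\<^sup>2"
    by (rule power_mono) (use norm_triangle_ineq[of "x - x'" "x' - y"] in \<open>auto simp: norm_minus_commute\<close>)
  also have "\<dots> \<le> 2 * (norm (x' - x))\<^sup>2 + 2 * (norm (x' - y))\<^sup>2"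
    using sum_squares_bound[of "norm (x' - x)" "norm (x' - y)"] by (simp add: power2_sum)
  finally have "- (norm (x' - y))\<^sup>2 / (4 * s) \<le> (norm (x' - x))\<^sup>2 / (4 * s) + - (norm (x - y))\<^sup>2 / (4 * (2 * s))"
    using s by (simp add: field_simps)
  then have "exp (- (norm (x' - y))\<^sup>2 / (4 * s)) \<le> exp ((norm (x' - x))\<^sup>2 / (4 * s)) * exp (- (norm (x - y))\<^sup>2 / (4 * (2 * s)))"
    by (simp only: exp_add[symmetric] exp_le_cancel_iff)
  then have "(4 * pi * s) powr (- real CARD('n) / 2) * exp (- (norm (x' - y))\<^sup>2 / (4 * s))
     \<le> (4 * pi * s) powr (- real CARD('n) / 2) * (exp ((norm (x' - x))\<^sup>2 / (4 * s)) * exp (- (norm (x - y))\<^sup>2 / (4 * (2 * s))))"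
    by (rule mult_left_mono) simp
  moreover have "(4 * pi * s) powr (- real CARD('n) / 2) = 2 powr (real CARD('n) / 2) * (4 * pi * (2 * s)) powr (- real CARD('n) / 2)"
  proof -
    have "4 * pi * (2 * s) = 2 * (4 * pi * s)" by simp
    then show ?thesis using s by (simp only: powr_mult) (simp add: powr_minus)
  qed
  ultimately show ?thesis
    unfolding heat_kernel_def by (simp add: mult_ac)
qed

section \<open>The heat semigroup on bounded functions\<close>

lemma heat_semigroup_pos: "0 < t \<Longrightarrow> heat_semigroup t \<phi> x = (LINT y|lborel. heat_kernel t (x - y) * \<phi> y)"
  by (simp add: heat_semigroup_def)

lemma bcontfunD:
  fixes f :: "'a :: topological_space \<Rightarrow> real"
  assumes "f \<in> bcontfun"
  obtains B where "0 \<le> B" "\<And>x. \<bar>f x\<bar> \<le> B" "continuous_on UNIV f"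
  using assms unfolding bcontfun_def bounded_pos by (auto intro: less_imp_le)

text \<open>
  The substitution \<open>y = x + sqrt t *\<^sub>R z\<close> turns the singular kernel at \<open>t = 0\<close> into a fixed one,
  which gives continuity down to \<open>t = 0\<close>.
\<close>
lemma heat_semigroup_unit_kernel:
  fixes \<phi> :: "real ^ 'n \<Rightarrow> real"
  assumes "\<phi> \<in> borel_measurable borel" "0 \<le> t"
  shows "heat_semigroup t \<phi> x = (LINT z|lborel. heat_kernel 1 z * \<phi> (x + sqrt t *\<^sub>R z))"
proof (cases "t = 0")
  case True
  then show ?thesis
    using has_bochner_integral_heat_kernel_0[OF zero_less_one, where 'n='n]
    by (simp add: heat_semigroup_def has_bochner_integral_iff)
next
  case False
  then show ?thesis
    using assms heat_integral_scale(1)[of \<phi> t x] by (simp add: heat_semigroup_pos)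
qed

lemma heat_kernel_integrable_bounded:
  fixes \<phi> :: "real ^ 'n \<Rightarrow> real"
  assumes [measurable]: "\<phi> \<in> borel_measurable borel" and "\<And>y. \<bar>\<phi> y\<bar> \<le> B" "0 < t"
  shows "integrable lborel (\<lambda>y. heat_kernel t (x - y) * \<phi> y)"
proof (rule Bochner_Integration.integrable_bound)
  show "integrable lborel (\<lambda>y. B * heat_kernel t (x - y))"
    by (intro integrable_mult_right heat_kernel_integral assms(3))
  have "\<bar>\<phi> y\<bar> \<le> \<bar>B\<bar>" for y using assms(2)[of y] by simp
  then show "AE y in lborel. norm (heat_kernel t (x - y) * \<phi> y) \<le> norm (B * heat_kernel t (x - y))"
    by (auto simp: abs_mult mult.commute[of "\<bar>B\<bar>"] intro!: mult_left_mono AE_I2)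
qed simp

lemma heat_semigroup_abs_le:
  fixes \<phi> :: "real ^ 'n \<Rightarrow> real"
  assumes [measurable]: "\<phi> \<in> borel_measurable borel" and B: "\<And>y. \<bar>\<phi> y\<bar> \<le> B" and t: "0 \<le> t"
  shows "\<bar>heat_semigroup t \<phi> x\<bar> \<le> B"
proof (cases "t = 0")
  case True
  then show ?thesis using B by (simp add: heat_semigroup_def)
next
  case False
  then have t: "0 < t" using t by simp
  have "\<bar>LINT y|lborel. heat_kernel t (x - y) * \<phi> y\<bar> \<le> (LINT y|lborel. heat_kernel t (x - y) * \<bar>\<phi> y\<bar>)"
    using integral_abs_bound[of lborel "\<lambda>y. heat_kernel t (x - y) * \<phi> y"] by (simp add: abs_mult)
  also have "\<dots> \<le> (LINT y|lborel. heat_kernel t (x - y) * B)"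
    using B t by (intro integral_mono heat_kernel_integrable_bounded[of _ B]) (auto intro!: mult_left_mono heat_kernel_integral order_trans[OF abs_ge_zero B])
  also have "\<dots> = B" using heat_kernel_integral[OF t, of x] by simp
  finally show ?thesis using t by (simp add: heat_semigroup_pos)
qed

lemma heat_semigroup_nonneg:
  assumes "\<And>y. 0 \<le> \<phi> y"
  shows "0 \<le> heat_semigroup t \<phi> x"
  using assms by (auto simp: heat_semigroup_def intro!: integral_nonneg_AE)

text \<open>Formulated with the integral instead of \<open>heat_semigroup\<close> so that times of
  either sign are allowed: \<open>sqrt\<close> is continuous on the whole line. The forcing term
  uses it at \<open>T n - \<tau>\<close>, which can be negative where an indicator vanishes.\<close>

lemma tendsto_heat_unit_kernel:
  fixes \<phi> :: "real ^ 'n \<Rightarrow> real"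
  assumes \<phi>: "\<phi> \<in> bcontfun" and X: "X \<longlonglongrightarrow> x" and t: "T \<longlonglongrightarrow> t"
  shows "(\<lambda>n. LINT z|lborel. heat_kernel 1 z * \<phi> (X n + sqrt (T n) *\<^sub>R z))
    \<longlonglongrightarrow> (LINT z|lborel. heat_kernel 1 z * \<phi> (x + sqrt t *\<^sub>R z))"
proof -
  obtain B where B: "0 \<le> B" "\<And>x. \<bar>\<phi> x\<bar> \<le> B" "continuous_on UNIV \<phi>" using bcontfunD[OF \<phi>] by blast
  have [measurable]: "\<phi> \<in> borel_measurable borel" by (rule borel_measurable_continuous_onI[OF B(3)])
  show ?thesis
  proof (rule integral_dominated_convergence)
    show "integrable lborel (\<lambda>z. B * heat_kernel 1 (z :: real ^ 'n))"
      using has_bochner_integral_heat_kernel_0[OF zero_less_one, where 'n='n]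
      by (simp add: has_bochner_integral_iff)
    show "AE z in lborel. (\<lambda>n. heat_kernel 1 z * \<phi> (X n + sqrt (T n) *\<^sub>R z)) \<longlonglongrightarrow> heat_kernel 1 z * \<phi> (x + sqrt t *\<^sub>R z)"
      by (intro AE_I2 tendsto_mult tendsto_const isCont_tendsto_compose[of _ \<phi>] tendsto_add tendsto_scaleR tendsto_real_sqrt X t)
        (use B(3) in \<open>simp add: continuous_on_eq_continuous_at\<close>)
    show "AE z in lborel. norm (heat_kernel 1 z * \<phi> (X n + sqrt (T n) *\<^sub>R z)) \<le> B * heat_kernel 1 z" for n
      using B(2) by (auto simp: abs_mult mult.commute[of B] intro!: mult_left_mono)
  qed simp_all
qed

lemma heat_semigroup_tendsto:
  fixes \<phi> :: "real ^ 'n \<Rightarrow> real"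
  assumes \<phi>: "\<phi> \<in> bcontfun" and "X \<longlonglongrightarrow> x" "T \<longlonglongrightarrow> t" "\<And>n. 0 \<le> T n" "0 \<le> t"
  shows "(\<lambda>n. heat_semigroup (T n) \<phi> (X n)) \<longlonglongrightarrow> heat_semigroup t \<phi> x"
proof -
  have [measurable]: "\<phi> \<in> borel_measurable borel"
    using \<phi> by (auto simp: bcontfun_def intro: borel_measurable_continuous_onI)
  show ?thesis
    using tendsto_heat_unit_kernel[OF \<phi> assms(2,3)] assms(4,5) by (simp add: heat_semigroup_unit_kernel)
qed

lemma borel_measurable_heat_semigroup [measurable (raw)]:
  fixes \<phi> :: "'a \<Rightarrow> real ^ 'n \<Rightarrow> real"
  assumes [measurable]: "(\<lambda>(z, y). \<phi> z y) \<in> borel_measurable (M \<Otimes>\<^sub>M borel)"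
    "f \<in> borel_measurable M" "g \<in> borel_measurable M"
  shows "(\<lambda>z. heat_semigroup (f z) (\<phi> z) (g z)) \<in> borel_measurable M"
proof -
  have [measurable]: "(\<lambda>(z, y). \<phi> z y) \<in> borel_measurable (M \<Otimes>\<^sub>M lborel)"
    using assms(1) by (simp cong: measurable_cong_sets)
  have "(\<lambda>z. \<phi> z (g z)) \<in> borel_measurable M"
    using measurable_compose[OF measurable_Pair[OF measurable_ident_sets[OF refl] assms(3)] assms(1)] by simp
  then show ?thesis
    unfolding heat_semigroup_def by measurable
qed

text \<open>Fubini and the convolution formula for kernels. The conditions concern kernel integrals
  rather than a sup bound of \<open>\<phi>\<close>, since the law is applied to the unbounded
  products of the weight with a bounded function.\<close>

lemma heat_semigroup_semigroup:
  fixes \<phi> :: "real ^ 'n \<Rightarrow> real"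
  assumes [measurable]: "\<phi> \<in> borel_measurable borel" and s: "0 < s" and r: "0 < r"
    and i: "\<And>z. integrable lborel (\<lambda>y. heat_kernel r (z - y) * \<phi> y)"
    and B: "\<And>z. (LINT y|lborel. heat_kernel r (z - y) * \<bar>\<phi> y\<bar>) \<le> B"
  shows "heat_semigroup s (heat_semigroup r \<phi>) x = heat_semigroup (s + r) \<phi> x"
proof -
  define f where "f = (\<lambda>(z, y). heat_kernel s (x - z) * (heat_kernel r (z - y) * \<phi> y))"
  have fm [measurable]: "f \<in> borel_measurable (lborel \<Otimes>\<^sub>M lborel)" unfolding f_def by measurable
  have int: "integrable (lborel \<Otimes>\<^sub>M lborel) f"
  proof (rule lborel_pair.Fubini_integrable)
    show "integrable lborel (\<lambda>z. LINT y|lborel. norm (f (z, y)))"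
    proof (rule Bochner_Integration.integrable_bound)
      show "integrable lborel (\<lambda>z. B * heat_kernel s (x - z))"
        by (intro integrable_mult_right heat_kernel_integral s)
      have "0 \<le> (LINT y|lborel. heat_kernel r (z - y) * \<bar>\<phi> y\<bar>)" for z
        by (intro integral_nonneg_AE) auto
      then show "AE z in lborel. norm (LINT y|lborel. norm (f (z, y))) \<le> norm (B * heat_kernel s (x - z))"
        using B by (auto simp: f_def abs_mult mult.commute[of B] intro!: mult_left_mono order_trans[OF B])
    qed measurable
    show "AE z in lborel. integrable lborel (\<lambda>y. f (z, y))"
      using i by (simp add: f_def)
  qed simp
  have "heat_semigroup s (heat_semigroup r \<phi>) x = (LINT z|lborel. LINT y|lborel. f (z, y))"
    using s r by (simp add: heat_semigroup_pos f_def)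
  also have "\<dots> = (LINT y|lborel. LINT z|lborel. f (z, y))"
    using lborel_pair.Fubini_integral[of "curry f"] int by simp
  also have "\<dots> = (LINT y|lborel. heat_kernel (s + r) (x - y) * \<phi> y)"
  proof (rule Bochner_Integration.integral_cong)
    fix y :: "real ^ 'n"
    have "(LINT z|lborel. f (z, y)) = (LINT z|lborel. heat_kernel s (x - z) * heat_kernel r (z - y)) * \<phi> y"
      by (simp add: f_def mult.assoc[symmetric])
    then show "(LINT z|lborel. f (z, y)) = heat_kernel (s + r) (x - y) * \<phi> y"
      using heat_kernel_convolution[OF s r, of x y] by simp
  qed simp
  finally show ?thesis
    using s r by (simp add: heat_semigroup_pos)
qed

text \<open>Moves the semigroup inside the time integral by Fubini in time and space, then applies
  the semigroup law for each fixed \<open>\<tau>\<close>. The majorant \<open>b\<close> may blow up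
  in time, as (r - \<tau>)^k does at the upper end.\<close>

lemma heat_semigroup_duhamel:
  fixes F :: "real \<Rightarrow> real ^ 'n \<Rightarrow> real"
  assumes Fm [measurable]: "(\<lambda>(\<tau>, y). F \<tau> y) \<in> borel_measurable borel"
    and s: "0 < s"
    and i: "\<And>\<tau> z. \<tau> \<in> {0<..<r} \<Longrightarrow> integrable lborel (\<lambda>y. heat_kernel (r - \<tau>) (z - y) * F \<tau> y)"
    and b: "\<And>\<tau> z. \<tau> \<in> {0<..<r} \<Longrightarrow> (LINT y|lborel. heat_kernel (r - \<tau>) (z - y) * \<bar>F \<tau> y\<bar>) \<le> b \<tau>"
    and bi: "set_integrable lborel {0<..<r} b"
  shows "heat_semigroup s (\<lambda>z. LBINT \<tau>:{0<..<r}. heat_semigroup (r - \<tau>) (F \<tau>) z) x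
     = (LBINT \<tau>:{0<..<r}. heat_semigroup (s + r - \<tau>) (F \<tau>) x)"
proof -
  have Fm' [measurable]: "(\<lambda>(\<tau>, y). F \<tau> y) \<in> borel_measurable (borel \<Otimes>\<^sub>M borel)"
    using Fm by (simp add: borel_prod)
  define f where "f = (\<lambda>(\<tau>, z). indicator {0<..<r} \<tau> * (heat_kernel s (x - z) * heat_semigroup (r - \<tau>) (F \<tau>) z))"
  have hm [measurable]: "(\<lambda>p. heat_semigroup (r - fst p) (F (fst p)) (snd p)) \<in> borel_measurable (borel \<Otimes>\<^sub>M borel)"
    by measurable
  have fm [measurable]: "f \<in> borel_measurable (lborel \<Otimes>\<^sub>M lborel)"
    using hm unfolding f_def case_prod_beta by measurable
  have hb: "\<bar>heat_semigroup (r - \<tau>) (F \<tau>) z\<bar> \<le> b \<tau>" if "\<tau> \<in> {0<..<r}" for \<tau> z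
  proof -
    have "\<bar>heat_semigroup (r - \<tau>) (F \<tau>) z\<bar> \<le> (LINT y|lborel. \<bar>heat_kernel (r - \<tau>) (z - y) * F \<tau> y\<bar>)"
      using that by (simp add: heat_semigroup_pos integral_abs_bound)
    then show ?thesis using b[OF that, of z] by (simp add: abs_mult)
  qed
  have int: "integrable (lborel \<Otimes>\<^sub>M lborel) f"
  proof (rule lborel_pair.Fubini_integrable)
    show "AE \<tau> in lborel. integrable lborel (\<lambda>z. f (\<tau>, z))"
    proof (rule AE_I2)
      fix \<tau> :: real
      have [measurable]: "F \<tau> \<in> borel_measurable borel"
        using measurable_compose[OF measurable_Pair1' Fm'] by simp
      show "integrable lborel (\<lambda>z. f (\<tau>, z))"
      proof (cases "\<tau> \<in> {0<..<r}")
        case True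
        have "(\<lambda>z. heat_semigroup (r - \<tau>) (F \<tau>) z) \<in> borel_measurable borel"
          by measurable
        from heat_kernel_integrable_bounded[OF this hb[OF True] s] True show ?thesis
          by (simp add: f_def)
      qed (simp add: f_def)
    qed
    show "integrable lborel (\<lambda>\<tau>. LINT z|lborel. norm (f (\<tau>, z)))"
    proof (rule Bochner_Integration.integrable_bound)
      show "integrable lborel (\<lambda>\<tau>. indicator {0<..<r} \<tau> * b \<tau>)"
        using bi by (simp add: set_integrable_def)
      have "norm (LINT z|lborel. norm (f (\<tau>, z))) \<le> norm (indicator {0<..<r} \<tau> * b \<tau>)" for \<tau>
      proof (cases "\<tau> \<in> {0<..<r}")
        case True
        have [measurable]: "F \<tau> \<in> borel_measurable borel"
          using measurable_compose[OF measurable_Pair1' Fm'] by simp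
        have "\<bar>heat_semigroup s (\<lambda>z. \<bar>heat_semigroup (r - \<tau>) (F \<tau>) z\<bar>) x\<bar> \<le> b \<tau>"
          using s hb[OF True] by (intro heat_semigroup_abs_le) auto
        then show ?thesis
          using True s by (simp add: f_def abs_mult heat_semigroup_pos)
      qed (simp add: f_def)
      then show "AE \<tau> in lborel. norm (LINT z|lborel. norm (f (\<tau>, z))) \<le> norm (indicator {0<..<r} \<tau> * b \<tau>)"
        by simp
    qed measurable
  qed simp
  have "heat_semigroup s (\<lambda>z. LBINT \<tau>:{0<..<r}. heat_semigroup (r - \<tau>) (F \<tau>) z) x
     = (LINT z|lborel. LINT \<tau>|lborel. f (\<tau>, z))"
    using s by (simp add: heat_semigroup_pos[of s] f_def set_lebesgue_integral_def mult.left_commute[of _ "heat_kernel _ _"])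
  also have "\<dots> = (LINT \<tau>|lborel. LINT z|lborel. f (\<tau>, z))"
    using lborel_pair.Fubini_integral[of "curry f"] int by simp
  also have "\<dots> = (LBINT \<tau>:{0<..<r}. heat_semigroup (s + r - \<tau>) (F \<tau>) x)"
    unfolding set_lebesgue_integral_def
  proof (rule Bochner_Integration.integral_cong)
    fix \<tau> :: real
    have [measurable]: "F \<tau> \<in> borel_measurable borel"
      using measurable_compose[OF measurable_Pair1' Fm'] by simp
    show "(LINT z|lborel. f (\<tau>, z)) = indicator {0<..<r} \<tau> *\<^sub>R heat_semigroup (s + r - \<tau>) (F \<tau>) x"
    proof (cases "\<tau> \<in> {0<..<r}")
      case True
      then have "heat_semigroup s (heat_semigroup (r - \<tau>) (F \<tau>)) x = heat_semigroup (s + (r - \<tau>)) (F \<tau>) x"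
        using s i b by (intro heat_semigroup_semigroup) auto
      then show ?thesis
        using True s by (simp add: f_def heat_semigroup_pos[of s] add_diff_eq)
    qed (simp add: f_def)
  qed simp
  finally show ?thesis .
qed

section \<open>Duhamel integrals with a singular weight\<close>

lemma tendsto_indicator_Ioo:
  fixes t s :: real
  assumes "T \<longlonglongrightarrow> t" "s \<noteq> t"
  shows "(\<lambda>n. indicator {0<..<T n} s :: real) \<longlonglongrightarrow> indicator {0<..<t} s"
proof (rule tendsto_eventually)
  show "\<forall>\<^sub>F n in sequentially. indicator {0<..<T n} s = (indicator {0<..<t} s :: real)"
  proof (cases "s < t")
    case True
    from order_tendstoD(1)[OF assms(1) True] show ?thesis
      by eventually_elim (use True in \<open>auto simp: indicator_def\<close>)
  next
    case False
    then have "t < s" using assms(2) by simp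
    from order_tendstoD(2)[OF assms(1) this] show ?thesis
      by eventually_elim (use False in \<open>auto simp: indicator_def\<close>)
  qed
qed

lemma set_integral_Ioo_split:
  fixes h :: "real \<Rightarrow> real"
  assumes h: "set_integrable lborel {0<..<r + s} h" and "0 \<le> r" "0 \<le> s"
  shows "(LBINT \<tau>:{0<..<r + s}. h \<tau>) = (LBINT \<tau>:{0<..<r}. h \<tau>) + (LBINT \<tau>:{0<..<s}. h (r + \<tau>))"
proof -
  let ?I = "\<lambda>A \<tau>. indicator A \<tau> *\<^sub>R h \<tau>"
  have i: "integrable lborel (?I {0<..<r + s})" using h by (simp add: set_integrable_def)
  have 1: "integrable lborel (?I {0<..<r})" "integrable lborel (?I {r<..<r + s})"
    using set_integrable_subset[OF h, of "{0<..<r}"] set_integrable_subset[OF h, of "{r<..<r + s}"] assms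
    by (auto simp: set_integrable_def subset_eq)
  have "(LINT \<tau>|lborel. ?I {0<..<r + s} \<tau>) = (LINT \<tau>|lborel. ?I {0<..<r} \<tau> + ?I {r<..<r + s} \<tau>)"
  proof (rule integral_cong_AE)
    show "AE \<tau> in lborel. ?I {0<..<r + s} \<tau> = ?I {0<..<r} \<tau> + ?I {r<..<r + s} \<tau>"
      using AE_lborel_singleton[of r] by eventually_elim (use assms in \<open>auto simp: indicator_def\<close>)
  qed (use i 1 in \<open>auto intro: borel_measurable_integrable borel_measurable_add\<close>)
  also have "\<dots> = (LINT \<tau>|lborel. ?I {0<..<r} \<tau>) + (LINT \<tau>|lborel. ?I {r<..<r + s} \<tau>)"
    by (rule Bochner_Integration.integral_add[OF 1])
  also have "(LINT \<tau>|lborel. ?I {r<..<r + s} \<tau>) = (LINT \<tau>|lborel. ?I {r<..<r + s} (r + 1 * \<tau>))"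
    by (subst lborel_integral_real_affine[of 1 _ r]) simp_all
  also have "\<dots> = (LINT \<tau>|lborel. indicator {0<..<s} \<tau> *\<^sub>R h (r + \<tau>))"
    by (rule Bochner_Integration.integral_cong) (auto simp: indicator_def)
  finally show ?thesis by (simp add: set_lebesgue_integral_def)
qed

lemma set_integral_Ioo_reflect:
  fixes h :: "real \<Rightarrow> real"
  shows "(LBINT \<tau>:{0<..<t}. h \<tau>) = (LBINT s:{0<..<t}. h (t - s))"
proof -
  have "(LINT \<tau>|lborel. indicator {0<..<t} \<tau> *\<^sub>R h \<tau>) = (LINT s|lborel. indicator {0<..<t} (t + - 1 * s) *\<^sub>R h (t + - 1 * s))"
    by (subst lborel_integral_real_affine[of "- 1" _ t]) simp_all
  also have "\<dots> = (LINT s|lborel. indicator {0<..<t} s *\<^sub>R h (t - s))"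
    by (rule Bochner_Integration.integral_cong) (auto simp: indicator_def)
  finally show ?thesis by (simp add: set_lebesgue_integral_def)
qed

lemma set_integrable_Ioo_reflect:
  fixes h :: "real \<Rightarrow> real"
  assumes "set_integrable lborel {0<..<t} (\<lambda>s. h (t - s))"
  shows "set_integrable lborel {0<..<t} h"
proof -
  have "integrable lborel (\<lambda>s. indicator {0<..<t} (t + - 1 * s) *\<^sub>R h (t + - 1 * s))"
    using assms unfolding set_integrable_def
    by (rule Bochner_Integration.integrable_cong[THEN iffD1, rotated -1]) (auto simp: indicator_def)
  then show ?thesis
    unfolding set_integrable_def by (subst (asm) lborel_integrable_real_affine_iff) simp_all
qed

definition joint_cb :: "real \<Rightarrow> (real \<Rightarrow> 'a :: topological_space \<Rightarrow> real) \<Rightarrow> bool" where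
  "joint_cb B g \<longleftrightarrow> continuous_on UNIV (\<lambda>(t, x). g t x) \<and> (\<forall>t x. \<bar>g t x\<bar> \<le> B)"

lemma heat_semigroup_0 [simp]: "heat_semigroup t (\<lambda>_. 0) x = 0"
  by (cases "t = 0") (simp_all add: heat_semigroup_def)

lemma joint_cb_borel:
  fixes g :: "real \<Rightarrow> real ^ 'n \<Rightarrow> real"
  assumes "joint_cb B g"
  shows "(\<lambda>(t, x). g t x) \<in> borel_measurable (borel \<Otimes>\<^sub>M borel)" "g t \<in> borel_measurable borel"
    "(\<lambda>(t, x). g t x) \<in> borel_measurable borel"
proof -
  show 1: "(\<lambda>(t, x). g t x) \<in> borel_measurable borel"
    using assms by (auto simp: joint_cb_def intro: borel_measurable_continuous_onI)
  then show 2: "(\<lambda>(t, x). g t x) \<in> borel_measurable (borel \<Otimes>\<^sub>M borel)" by (simp add: borel_prod)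
  show "g t \<in> borel_measurable borel"
    using measurable_compose[OF measurable_Pair1' 2] by simp
qed

lemma joint_cb_bound: "joint_cb B g \<Longrightarrow> \<bar>g t x\<bar> \<le> B"
  by (simp add: joint_cb_def)

lemma joint_cb_tendsto:
  fixes g :: "real \<Rightarrow> 'a :: t2_space \<Rightarrow> real"
  assumes "joint_cb B g" "T \<longlonglongrightarrow> t" "X \<longlonglongrightarrow> x"
  shows "(\<lambda>n. g (T n) (X n)) \<longlonglongrightarrow> g t x"
proof -
  have "isCont (\<lambda>(t, x). g t x) (t, x)"
    using assms(1) by (simp add: joint_cb_def continuous_on_eq_continuous_at)
  from isCont_tendsto_compose[OF this tendsto_Pair[OF assms(2,3)]] show ?thesis by simp
qed

lemma joint_cb_nonneg: "joint_cb B g \<Longrightarrow> 0 \<le> B"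
  by (meson abs_ge_zero joint_cb_bound order_trans)

lemma joint_cb_diff:
  assumes "joint_cb A f" "joint_cb B g"
  shows "joint_cb (A + B) (\<lambda>t x. f t x - g t x)"
  unfolding joint_cb_def
proof (intro conjI allI)
  show "continuous_on UNIV (\<lambda>(t, x). f t x - g t x)"
    using assms unfolding joint_cb_def case_prod_beta by (auto intro!: continuous_intros)
  show "\<bar>f t x - g t x\<bar> \<le> A + B" for t x
    using joint_cb_bound[OF assms(1), of t x] joint_cb_bound[OF assms(2), of t x] by linarith
qed

text \<open>Collects what the nonlinear term uses of |y|^\<alpha>: measurability, sign, and
  smoothing at the rate t^k, integrable at 0 because k > -1. The instance is k = \<alpha>/2.\<close>

locale heat_weight =
  fixes W :: "real ^ 'n \<Rightarrow> real" and C k :: real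
  assumes W_borel [measurable]: "W \<in> borel_measurable borel"
    and W_nonneg: "0 \<le> W x"
    and C_pos: "0 < C"
    and k_gt: "- 1 < k"
    and W_integrable: "0 < t \<Longrightarrow> integrable lborel (\<lambda>y. heat_kernel t (x - y) * W y)"
    and W_le: "0 < t \<Longrightarrow> (LINT y|lborel. heat_kernel t (x - y) * W y) \<le> C * t powr k"
begin

lemma weighted_integrable:
  assumes [measurable]: "\<phi> \<in> borel_measurable borel" and B: "\<And>y. \<bar>\<phi> y\<bar> \<le> B" and t: "0 < t"
  shows "integrable lborel (\<lambda>y. heat_kernel t (x - y) * (W y * \<phi> y))"
    and "(LINT y|lborel. heat_kernel t (x - y) * \<bar>W y * \<phi> y\<bar>) \<le> B * C * t powr k"
    and "\<bar>heat_semigroup t (\<lambda>y. W y * \<phi> y) x\<bar> \<le> B * C * t powr k"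
proof -
  have B0: "0 \<le> B" using B[of 0] by linarith
  have le: "heat_kernel t (x - y) * \<bar>W y * \<phi> y\<bar> \<le> B * (heat_kernel t (x - y) * W y)" for y
  proof -
    have "heat_kernel t (x - y) * W y * \<bar>\<phi> y\<bar> \<le> heat_kernel t (x - y) * W y * B"
      using B W_nonneg by (intro mult_left_mono) auto
    then show ?thesis using W_nonneg by (simp add: abs_mult mult_ac)
  qed
  have i: "integrable lborel (\<lambda>y. B * (heat_kernel t (x - y) * W y))"
    by (intro integrable_mult_right W_integrable t)
  have 0: "0 \<le> B * (heat_kernel t (x - y) * W y)" for y
    using B0 W_nonneg by simp
  show 1: "integrable lborel (\<lambda>y. heat_kernel t (x - y) * (W y * \<phi> y))"
    by (rule Bochner_Integration.integrable_bound[OF i]) (use le 0 W_nonneg B0 in \<open>auto simp: abs_mult intro!: AE_I2 order_trans[OF _ abs_ge_self]\<close>)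
  then have "integrable lborel (\<lambda>y. heat_kernel t (x - y) * \<bar>W y * \<phi> y\<bar>)"
    using integrable_abs[OF 1] by (simp add: abs_mult)
  then have "(LINT y|lborel. heat_kernel t (x - y) * \<bar>W y * \<phi> y\<bar>) \<le> (LINT y|lborel. B * (heat_kernel t (x - y) * W y))"
    using i le by (intro integral_mono)
  also have "\<dots> \<le> B * (C * t powr k)"
    using mult_left_mono[OF W_le[OF t] B0] by simp
  finally show 2: "(LINT y|lborel. heat_kernel t (x - y) * \<bar>W y * \<phi> y\<bar>) \<le> B * C * t powr k"
    by simp
  show "\<bar>heat_semigroup t (\<lambda>y. W y * \<phi> y) x\<bar> \<le> B * C * t powr k"
    using t 2 W_nonneg
      integral_abs_bound[of lborel "\<lambda>y. heat_kernel t (x - y) * (W y * \<phi> y)"]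
    by (simp add: heat_semigroup_pos abs_mult)
qed

definition duhamel :: "(real \<Rightarrow> real ^ 'n \<Rightarrow> real) \<Rightarrow> real \<Rightarrow> real ^ 'n \<Rightarrow> real" where
  "duhamel g t x = (LBINT \<tau>:{0<..<t}. heat_semigroup (t - \<tau>) (\<lambda>y. W y * g \<tau> y) x)"

lemma duhamel_cong:
  assumes "\<And>\<tau> y. 0 < \<tau> \<Longrightarrow> \<tau> < t \<Longrightarrow> g \<tau> y = h \<tau> y"
  shows "duhamel g t x = duhamel h t x"
  unfolding duhamel_def set_lebesgue_integral_def
  by (rule Bochner_Integration.integral_cong) (use assms in \<open>auto simp: indicator_def heat_semigroup_def\<close>)

text \<open>In this form a single function \<open>B * C * s powr k\<close> dominates the integrands for all \<open>t\<close> and \<open>x\<close>.\<close>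
lemma duhamel_reflect:
  "duhamel g t x = (LBINT s:{0<..<t}. heat_semigroup s (\<lambda>y. W y * g (t - s) y) x)"
  unfolding duhamel_def by (subst set_integral_Ioo_reflect) simp

text \<open>The substitution used for continuous data would move the singularity of \<open>W\<close>
  along with \<open>X n\<close>. Here the time \<open>s\<close> is fixed and positive, so the
  dependence on the base point is left in the kernel, which is smooth.\<close>

lemma weighted_tendsto:
  assumes g: "joint_cb B g" and s: "0 < s" and T: "T \<longlonglongrightarrow> \<tau>" and X: "X \<longlonglongrightarrow> x"
  shows "(\<lambda>n. heat_semigroup s (\<lambda>y. W y * g (T n) y) (X n)) \<longlonglongrightarrow> heat_semigroup s (\<lambda>y. W y * g \<tau> y) x"
proof -
  have [measurable]: "g t \<in> borel_measurable borel" for t by (rule joint_cb_borel[OF g])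
  obtain M where M: "\<And>n. norm (X n - x) \<le> M"
    using convergent_imp_Bseq[OF convergentI[OF tendsto_diff[OF X tendsto_const[of x]]]]
    by (auto simp: Bseq_def)
  have B0: "0 \<le> B" by (rule joint_cb_nonneg[OF g])
  \<comment> \<open>The constant of \<open>heat_kernel_shift_le\<close> for the largest displacement
    \<open>M\<close> of the sequence from \<open>x\<close>, times the bound of
    \<open>g\<close>.\<close>
  define A where "A = 2 powr (real CARD('n) / 2) * exp (M\<^sup>2 / (4 * s)) * B"
  have A0: "0 \<le> A" using B0 by (simp add: A_def)
  have "(\<lambda>n. LINT y|lborel. heat_kernel s (X n - y) * (W y * g (T n) y)) \<longlonglongrightarrow>
    (LINT y|lborel. heat_kernel s (x - y) * (W y * g \<tau> y))"
  proof (rule integral_dominated_convergence)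
    show "integrable lborel (\<lambda>y. A * (heat_kernel (2 * s) (x - y) * W y))"
      using s by (intro integrable_mult_right W_integrable) simp
    have "isCont (heat_kernel s) z" for z :: "real ^ 'n"
      unfolding heat_kernel_def using s by (intro continuous_intros) auto
    then show "AE y in lborel. (\<lambda>n. heat_kernel s (X n - y) * (W y * g (T n) y)) \<longlonglongrightarrow> heat_kernel s (x - y) * (W y * g \<tau> y)"
      by (intro AE_I2 tendsto_mult tendsto_const joint_cb_tendsto[OF g] T isCont_tendsto_compose[of _ "heat_kernel s"] tendsto_diff X)
    show "AE y in lborel. norm (heat_kernel s (X n - y) * (W y * g (T n) y)) \<le> A * (heat_kernel (2 * s) (x - y) * W y)" for n
    proof (rule AE_I2)
      fix y
      have "heat_kernel s (X n - y) \<le> 2 powr (real CARD('n) / 2) * exp ((norm (X n - x))\<^sup>2 / (4 * s)) * heat_kernel (2 * s) (x - y)"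
        by (rule heat_kernel_shift_le[OF s])
      also have "\<dots> \<le> 2 powr (real CARD('n) / 2) * exp (M\<^sup>2 / (4 * s)) * heat_kernel (2 * s) (x - y)"
        using s M[of n] by (intro mult_right_mono mult_left_mono) (auto intro!: divide_right_mono power_mono)
      finally have "heat_kernel s (X n - y) * (W y * \<bar>g (T n) y\<bar>)
        \<le> 2 powr (real CARD('n) / 2) * exp (M\<^sup>2 / (4 * s)) * heat_kernel (2 * s) (x - y) * (W y * B)"
        using W_nonneg joint_cb_bound[OF g] by (intro mult_mono mult_left_mono) auto
      then show "norm (heat_kernel s (X n - y) * (W y * g (T n) y)) \<le> A * (heat_kernel (2 * s) (x - y) * W y)"
        using W_nonneg by (simp add: abs_mult A_def mult_ac)
    qed
  qed simp_all
  then show ?thesis using s by (simp add: heat_semigroup_pos)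
qed

lemma weighted_measurable:
  assumes g: "joint_cb B g"
  shows "(\<lambda>s. heat_semigroup s (\<lambda>y. W y * g (t - s) y) x) \<in> borel_measurable borel"
    and "(\<lambda>(\<tau>, y). W y * g \<tau> y) \<in> borel_measurable borel"
proof -
  note [measurable] = joint_cb_borel(1)[OF g]
  show "(\<lambda>s. heat_semigroup s (\<lambda>y. W y * g (t - s) y) x) \<in> borel_measurable borel"
    by measurable
  have "(\<lambda>(\<tau>, y). W y * g \<tau> y) \<in> borel_measurable (borel \<Otimes>\<^sub>M borel)" by measurable
  then show "(\<lambda>(\<tau>, y). W y * g \<tau> y) \<in> borel_measurable borel" by (simp add: borel_prod)
qed

lemma duhamel_integrable:
  assumes g: "joint_cb B g" and t: "0 \<le> t"
  shows "set_integrable lborel {0<..<t} (\<lambda>s. heat_semigroup s (\<lambda>y. W y * g (t - s) y) x)"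
    and "set_integrable lborel {0<..<t} (\<lambda>\<tau>. heat_semigroup (t - \<tau>) (\<lambda>y. W y * g \<tau> y) x)"
proof -
  note [measurable] = weighted_measurable(1)[OF g]
  show 1: "set_integrable lborel {0<..<t} (\<lambda>s. heat_semigroup s (\<lambda>y. W y * g (t - s) y) x)"
  proof (rule set_integrable_bound[where f="\<lambda>s. B * C * s powr k"])
    show "set_integrable lborel {0<..<t} (\<lambda>s. B * C * s powr k)"
      using set_integral_powr_Ioo(1)[OF k_gt t] by (intro set_integrable_mult_right)
    show "set_borel_measurable lborel {0<..<t} (\<lambda>s. heat_semigroup s (\<lambda>y. W y * g (t - s) y) x)"
      unfolding set_borel_measurable_def by measurable
    show "AE s in lborel. s \<in> {0<..<t} \<longrightarrow> norm (heat_semigroup s (\<lambda>y. W y * g (t - s) y) x) \<le> norm (B * C * s powr k)"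
      using weighted_integrable(3)[OF joint_cb_borel(2)[OF g] joint_cb_bound[OF g]]
      by (intro AE_I2 impI) (auto intro: order_trans[OF _ abs_ge_self])
  qed
  show "set_integrable lborel {0<..<t} (\<lambda>\<tau>. heat_semigroup (t - \<tau>) (\<lambda>y. W y * g \<tau> y) x)"
    using 1 by (subst set_integrable_Ioo_reflect) simp_all
qed

text \<open>A source that is switched on only at time \<open>a\<close> contributes in proportion to
  (t - a)^(k+1), however late \<open>a\<close> is. With \<open>a = 0\<close> this is the plain
  bound; with \<open>a > 0\<close> it gives smallness on a short window far from time 0.\<close>

lemma duhamel_abs_le:
  assumes g: "joint_cb B g" and a: "0 \<le> a" "a \<le> t"
    and zero: "\<And>\<tau> y. 0 < \<tau> \<Longrightarrow> \<tau> < a \<Longrightarrow> g \<tau> y = 0"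
    and le: "\<And>\<tau> y. a \<le> \<tau> \<Longrightarrow> \<tau> < t \<Longrightarrow> \<bar>g \<tau> y\<bar> \<le> E"
  shows "\<bar>duhamel g t x\<bar> \<le> E * C * ((t - a) powr (k + 1) / (k + 1))"
proof (cases "a = t")
  \<comment> \<open>Here the bound by \<open>E\<close> is vacuous and \<open>E\<close> could be
    negative, but the right-hand side is 0 because \<open>0 powr (k + 1) = 0\<close>.\<close>
  case True
  have "duhamel g t x = duhamel (\<lambda>_ _. 0) t x"
    by (rule duhamel_cong) (use zero True in auto)
  also have "\<dots> = 0"
    by (simp add: duhamel_def)
  finally show ?thesis using True by simp
next
  case False
  then have at: "a < t" using a by simp
  then have E0: "0 \<le> E" using le[of a undefined] by linarith
  let ?h = "\<lambda>s. heat_semigroup s (\<lambda>y. W y * g (t - s) y) x"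
  have i: "set_integrable lborel {0<..<t} (\<lambda>s. indicator {0<..<t - a} s * (E * C * s powr k))"
  proof -
    have "set_integrable lborel {0<..<t - a} (\<lambda>s. E * C * s powr k)"
      using set_integral_powr_Ioo(1)[OF k_gt, of "t - a"] at by (intro set_integrable_mult_right) auto
    then show ?thesis
      unfolding set_integrable_def
      by (rule Bochner_Integration.integrable_cong[THEN iffD1, rotated -1])
        (use a in \<open>auto simp: indicator_def\<close>)
  qed
  \<comment> \<open>At \<open>s = t - a\<close> the source is evaluated at time \<open>a\<close>,
    where it need not vanish although the indicator does; this single point is left out.\<close>
  have pw: "\<bar>?h s\<bar> \<le> indicator {0<..<t - a} s * (E * C * s powr k)" if "0 < s" "s < t" "s \<noteq> t - a" for s
  proof (cases "s < t - a")
    case True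
    have "\<bar>?h s\<bar> \<le> E * C * s powr k"
      by (rule weighted_integrable(3)[OF joint_cb_borel(2)[OF g]]) (use le True that in auto)
    then show ?thesis using True that by simp
  next
    case False
    then have "(\<lambda>y. W y * g (t - s) y) = (\<lambda>y. 0)"
      using zero that a by auto
    then show ?thesis using E0 C_pos by (simp add: indicator_def)
  qed
  have "\<bar>duhamel g t x\<bar> \<le> (LINT s|lborel. \<bar>indicator {0<..<t} s *\<^sub>R ?h s\<bar>)"
    unfolding duhamel_reflect set_lebesgue_integral_def by (rule integral_abs_bound)
  also have "\<dots> \<le> (LINT s|lborel. indicator {0<..<t} s *\<^sub>R (indicator {0<..<t - a} s * (E * C * s powr k)))"
  proof (rule integral_mono_AE)
    show "integrable lborel (\<lambda>s. \<bar>indicator {0<..<t} s *\<^sub>R ?h s\<bar>)"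
      using duhamel_integrable(1)[OF g, of t x] a by (intro integrable_abs) (simp add: set_integrable_def)
    show "AE s in lborel. \<bar>indicator {0<..<t} s *\<^sub>R ?h s\<bar> \<le> indicator {0<..<t} s *\<^sub>R (indicator {0<..<t - a} s * (E * C * s powr k))"
      using AE_lborel_singleton[of "t - a"]
      by eventually_elim (use pw in \<open>auto simp: indicator_def abs_mult\<close>)
  qed (use i in \<open>simp add: set_integrable_def\<close>)
  also have "\<dots> = (LBINT s:{0<..<t - a}. E * C * s powr k)"
    unfolding set_lebesgue_integral_def
    by (rule Bochner_Integration.integral_cong) (use a in \<open>auto simp: indicator_def\<close>)
  also have "\<dots> = E * C * ((t - a) powr (k + 1) / (k + 1))"
    using set_integral_powr_Ioo(2)[OF k_gt, of "t - a"] at by simp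
  finally show ?thesis .
qed

text \<open>The moving upper limit is written as an indicator, which converges except at
  \<open>s = t\<close>. After reflection the majorant is the same for all n: a multiple of
  \<open>s powr k\<close> on (0, M), with \<open>M\<close> bounding the sequence of times.\<close>

lemma duhamel_tendsto:
  assumes g: "joint_cb B g" and T: "T \<longlonglongrightarrow> t" and X: "X \<longlonglongrightarrow> x"
  shows "(\<lambda>n. duhamel g (T n) (X n)) \<longlonglongrightarrow> duhamel g t x"
proof -
  note [measurable] = weighted_measurable(1)[OF g]
  obtain M where M: "\<And>n. \<bar>T n\<bar> \<le> M" "0 < M"
    using convergent_imp_Bseq[OF convergentI[OF T]] by (auto simp: Bseq_def)
  show ?thesis
    unfolding duhamel_reflect set_lebesgue_integral_def
  proof (rule integral_dominated_convergence)
    have "set_integrable lborel {0<..<M} (\<lambda>s. B * C * s powr k)"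
      using set_integral_powr_Ioo(1)[OF k_gt, of M] M(2) by (intro set_integrable_mult_right) simp
    then show "integrable lborel (\<lambda>s. indicator {0<..<M} s * (B * C * s powr k))"
      by (simp add: set_integrable_def)
    show "AE s in lborel. (\<lambda>n. indicator {0<..<T n} s *\<^sub>R heat_semigroup s (\<lambda>y. W y * g (T n - s) y) (X n))
      \<longlonglongrightarrow> indicator {0<..<t} s *\<^sub>R heat_semigroup s (\<lambda>y. W y * g (t - s) y) x"
      using AE_lborel_singleton[of t]
    proof eventually_elim
      fix s assume s: "s \<noteq> t"
      show "(\<lambda>n. indicator {0<..<T n} s *\<^sub>R heat_semigroup s (\<lambda>y. W y * g (T n - s) y) (X n))
        \<longlonglongrightarrow> indicator {0<..<t} s *\<^sub>R heat_semigroup s (\<lambda>y. W y * g (t - s) y) x"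
      proof (cases "0 < s")
        case True
        then show ?thesis
          by (intro tendsto_scaleR tendsto_indicator_Ioo[OF T s] weighted_tendsto[OF g] X tendsto_diff T tendsto_const)
      qed simp
    qed
    show "AE s in lborel. norm (indicator {0<..<T n} s *\<^sub>R heat_semigroup s (\<lambda>y. W y * g (T n - s) y) (X n))
      \<le> indicator {0<..<M} s * (B * C * s powr k)" for n
    proof (rule AE_I2)
      fix s
      have "T n \<le> M" using M(1)[of n] by linarith
      then show "norm (indicator {0<..<T n} s *\<^sub>R heat_semigroup s (\<lambda>y. W y * g (T n - s) y) (X n))
        \<le> indicator {0<..<M} s * (B * C * s powr k)"
        using weighted_integrable(3)[OF joint_cb_borel(2)[OF g] joint_cb_bound[OF g]] joint_cb_nonneg[OF g] C_pos
        by (auto simp: indicator_def abs_mult)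
    qed
  qed simp_all
qed

lemma duhamel_diff:
  assumes f: "joint_cb A f" and g: "joint_cb B g" and t: "0 \<le> t"
  shows "duhamel f t x - duhamel g t x = duhamel (\<lambda>\<tau> y. f \<tau> y - g \<tau> y) t x"
proof -
  have "duhamel f t x - duhamel g t x = (LBINT s:{0<..<t}. heat_semigroup s (\<lambda>y. W y * f (t - s) y) x - heat_semigroup s (\<lambda>y. W y * g (t - s) y) x)"
    unfolding duhamel_reflect
    by (rule set_integral_diff(2)[symmetric]) (rule duhamel_integrable(1)[OF f t] duhamel_integrable(1)[OF g t])+
  also have "\<dots> = duhamel (\<lambda>\<tau> y. f \<tau> y - g \<tau> y) t x"
    unfolding duhamel_reflect
  proof (rule set_lebesgue_integral_cong)
    show "\<forall>s. s \<in> {0<..<t} \<longrightarrow> heat_semigroup s (\<lambda>y. W y * f (t - s) y) x - heat_semigroup s (\<lambda>y. W y * g (t - s) y) x =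
      heat_semigroup s (\<lambda>y. W y * (f (t - s) y - g (t - s) y)) x"
      using weighted_integrable(1)[OF joint_cb_borel(2)[OF f] joint_cb_bound[OF f]]
        weighted_integrable(1)[OF joint_cb_borel(2)[OF g] joint_cb_bound[OF g]]
      by (auto simp: heat_semigroup_pos right_diff_distrib)
  qed simp
  finally show ?thesis .
qed

text \<open>Split the time integral at \<open>r\<close>. Before \<open>r\<close> the semigroup runs
  for \<open>s + (r - \<tau>)\<close>, and its part of length \<open>s\<close> can be pulled out;
  after \<open>r\<close> the integral is a Duhamel term of the translated source.\<close>

lemma duhamel_restart:
  assumes g: "joint_cb B g" and r: "0 \<le> r" and s: "0 < s"
  shows "duhamel g (r + s) x = heat_semigroup s (duhamel g r) x + duhamel (\<lambda>\<tau>. g (r + \<tau>)) s x"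
proof -
  have "duhamel g (r + s) x = (LBINT \<tau>:{0<..<r}. heat_semigroup (r + s - \<tau>) (\<lambda>y. W y * g \<tau> y) x)
     + (LBINT \<tau>:{0<..<s}. heat_semigroup (r + s - (r + \<tau>)) (\<lambda>y. W y * g (r + \<tau>) y) x)"
    unfolding duhamel_def using duhamel_integrable(2)[OF g, of "r + s" x] r s
    by (intro set_integral_Ioo_split) auto
  also have "(LBINT \<tau>:{0<..<r}. heat_semigroup (r + s - \<tau>) (\<lambda>y. W y * g \<tau> y) x)
    = (LBINT \<tau>:{0<..<r}. heat_semigroup (s + r - \<tau>) (\<lambda>y. W y * g \<tau> y) x)"
    by (simp add: add.commute)
  also have "\<dots> = heat_semigroup s (\<lambda>z. LBINT \<tau>:{0<..<r}. heat_semigroup (r - \<tau>) (\<lambda>y. W y * g \<tau> y) z) x"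
  proof (rule heat_semigroup_duhamel[symmetric, OF weighted_measurable(2)[OF g] s])
    show "integrable lborel (\<lambda>y. heat_kernel (r - \<tau>) (z - y) * (W y * g \<tau> y))" if "\<tau> \<in> {0<..<r}" for \<tau> z
      using weighted_integrable(1)[OF joint_cb_borel(2)[OF g] joint_cb_bound[OF g]] that by simp
    show "(LINT y|lborel. heat_kernel (r - \<tau>) (z - y) * \<bar>W y * g \<tau> y\<bar>) \<le> B * C * (r - \<tau>) powr k"
      if "\<tau> \<in> {0<..<r}" for \<tau> z
      using weighted_integrable(2)[OF joint_cb_borel(2)[OF g] joint_cb_bound[OF g]] that by simp
    have "set_integrable lborel {0<..<r} (\<lambda>s. B * C * s powr k)"
      using set_integral_powr_Ioo(1)[OF k_gt r] by (intro set_integrable_mult_right)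
    then show "set_integrable lborel {0<..<r} (\<lambda>\<tau>. B * C * (r - \<tau>) powr k)"
      by (subst set_integrable_Ioo_reflect) simp_all
  qed
  finally show ?thesis
    by (simp add: duhamel_def[abs_def])
qed

end

section \<open>The forcing term\<close>

definition forcing :: "(real \<Rightarrow> real) \<Rightarrow> (real ^ 'n \<Rightarrow> real) \<Rightarrow> real \<Rightarrow> real ^ 'n \<Rightarrow> real" where
  "forcing \<zeta> w t x = (LBINT \<tau>:{0<..<t}. heat_semigroup (t - \<tau>) (\<lambda>y. \<zeta> \<tau> * w y) x)"

lemma heat_semigroup_cmult: "heat_semigroup t (\<lambda>y. c * \<phi> y) x = c * heat_semigroup t \<phi> x"
  by (cases "t = 0") (simp_all add: heat_semigroup_def mult.left_commute[of _ c])

lemma set_integrable_abs_mono: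
  fixes f :: "real \<Rightarrow> real"
  assumes f: "set_integrable lborel A f" and g: "set_borel_measurable lborel A g"
    and le: "\<And>s. s \<in> A \<Longrightarrow> \<bar>g s\<bar> \<le> f s"
  shows "set_integrable lborel A g" "\<bar>LBINT s:A. g s\<bar> \<le> (LBINT s:A. f s)"
proof -
  show 1: "set_integrable lborel A g"
    using f g by (rule set_integrable_bound) (use le in \<open>auto intro: order_trans[OF _ abs_ge_self]\<close>)
  have "\<bar>LBINT s:A. g s\<bar> \<le> (LINT s|lborel. \<bar>indicator A s *\<^sub>R g s\<bar>)"
    unfolding set_lebesgue_integral_def by (rule integral_abs_bound)
  also have "\<dots> \<le> (LBINT s:A. f s)"
    unfolding set_lebesgue_integral_def
    by (rule integral_mono) (use f 1 le in \<open>auto simp: set_integrable_def indicator_def intro: integrable_abs\<close>)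
  finally show "\<bar>LBINT s:A. g s\<bar> \<le> (LBINT s:A. f s)" .
qed

context
  fixes w :: "real ^ 'n \<Rightarrow> real" and B :: real
  assumes w: "continuous_on UNIV w" and B: "\<And>x. \<bar>w x\<bar> \<le> B"
begin

lemma w_bcontfun: "w \<in> bcontfun"
  using w B by (auto simp: bcontfun_def bounded_iff)

lemma w_borel [measurable]: "w \<in> borel_measurable borel"
  using w by (rule borel_measurable_continuous_onI)

lemma forcing_set_integrable:
  assumes z: "set_integrable lborel {0<..<t} \<zeta>"
  shows "set_integrable lborel {0<..<t} (\<lambda>\<tau>. heat_semigroup (t - \<tau>) (\<lambda>y. \<zeta> \<tau> * w y) x)"
    and "\<bar>forcing \<zeta> w t x\<bar> \<le> B * (LBINT \<tau>:{0<..<t}. \<bar>\<zeta> \<tau>\<bar>)"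
proof -
  have 1: "set_integrable lborel {0<..<t} (\<lambda>\<tau>. B * \<bar>\<zeta> \<tau>\<bar>)"
    using set_integrable_abs[OF z] by (rule set_integrable_mult_right)
  \<comment> \<open>The values of \<open>\<zeta>\<close> outside (0, t) are arbitrary, so
    measurability is available only for the truncated function.\<close>
  have zm: "(\<lambda>\<tau>. indicator {0<..<t} \<tau> * \<zeta> \<tau>) \<in> borel_measurable borel"
    using z by (auto simp: set_integrable_def dest: borel_measurable_integrable)
  have "(\<lambda>\<tau>. (indicator {0<..<t} \<tau> * \<zeta> \<tau>) * heat_semigroup (t - \<tau>) w x) \<in> borel_measurable borel"
    by (rule borel_measurable_times[OF zm]) measurable
  then have 2: "set_borel_measurable lborel {0<..<t} (\<lambda>\<tau>. heat_semigroup (t - \<tau>) (\<lambda>y. \<zeta> \<tau> * w y) x)"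
    by (simp add: set_borel_measurable_def heat_semigroup_cmult mult.assoc)
  have 3: "\<bar>heat_semigroup (t - \<tau>) (\<lambda>y. \<zeta> \<tau> * w y) x\<bar> \<le> B * \<bar>\<zeta> \<tau>\<bar>" if "\<tau> \<in> {0<..<t}" for \<tau>
    using mult_left_mono[OF heat_semigroup_abs_le[OF w_borel B, of "t - \<tau>" x], of "\<bar>\<zeta> \<tau>\<bar>"] that
    by (simp add: heat_semigroup_cmult abs_mult mult.commute)
  show "set_integrable lborel {0<..<t} (\<lambda>\<tau>. heat_semigroup (t - \<tau>) (\<lambda>y. \<zeta> \<tau> * w y) x)"
    by (rule set_integrable_abs_mono(1)[OF 1 2 3])
  show "\<bar>forcing \<zeta> w t x\<bar> \<le> B * (LBINT \<tau>:{0<..<t}. \<bar>\<zeta> \<tau>\<bar>)"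
    using set_integrable_abs_mono(2)[OF 1 2 3] by (simp add: forcing_def)
qed

text \<open>In contrast to the nonlinear term, the integration variable stays in
  \<open>\<zeta>\<close>, which need not be continuous. The moving time appears only in the
  semigroup acting on the bounded continuous \<open>w\<close>, so a multiple of |\<zeta>|
  dominates.\<close>

lemma forcing_tendsto:
  assumes z: "\<And>T. set_integrable lborel {0<..<T} \<zeta>"
    and T: "T \<longlonglongrightarrow> t" and X: "X \<longlonglongrightarrow> x"
  shows "(\<lambda>n. forcing \<zeta> w (T n) (X n)) \<longlonglongrightarrow> forcing \<zeta> w t x"
proof -
  obtain M where M: "\<And>n. \<bar>T n\<bar> \<le> M" "0 < M"
    using convergent_imp_Bseq[OF convergentI[OF T]] by (auto simp: Bseq_def)
  have tM: "\<bar>t\<bar> \<le> M"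
    using M by (intro LIMSEQ_le_const2[OF tendsto_rabs[OF T]]) auto
  have TM: "T n < M + 1" for n using M(1)[of n] by linarith
  let ?H = "\<lambda>t x. LINT z|lborel. heat_kernel 1 z * w (x + sqrt t *\<^sub>R z)"
  \<comment> \<open>A cut-off of \<open>\<zeta>\<close> that is integrable on the whole line and
    agrees with it on every interval (0, T n) and on (0, t).\<close>
  define Z where "Z \<tau> = indicator {0<..<M + 1} \<tau> * \<zeta> \<tau>" for \<tau>
  have iz: "integrable lborel Z"
    using z[of "M + 1"] by (simp add: set_integrable_def Z_def[abs_def])
  then have zm [measurable]: "Z \<in> borel_measurable borel"
    by (auto dest: borel_measurable_integrable)
  have eq: "indicator {0<..<s} \<tau> *\<^sub>R heat_semigroup (s - \<tau>) (\<lambda>y. \<zeta> \<tau> * w y) x = indicator {0<..<s} \<tau> * (Z \<tau> * heat_semigroup (s - \<tau>) w x)"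
    if "s < M + 1" for s \<tau> x
    using that by (auto simp: heat_semigroup_cmult Z_def indicator_def)
  have eq': "indicator {0<..<s} \<tau> * (Z \<tau> * heat_semigroup (s - \<tau>) w x) = indicator {0<..<s} \<tau> * (Z \<tau> * ?H (s - \<tau>) x)" for s \<tau> x
    by (auto simp: indicator_def heat_semigroup_unit_kernel)
  have m [measurable]: "(\<lambda>\<tau>. indicator {0<..<s} \<tau> * (Z \<tau> * heat_semigroup (s - \<tau>) w x)) \<in> borel_measurable lborel" for s x
    by measurable
  have "(\<lambda>n. LINT \<tau>|lborel. indicator {0<..<T n} \<tau> * (Z \<tau> * heat_semigroup (T n - \<tau>) w (X n)))
    \<longlonglongrightarrow> (LINT \<tau>|lborel. indicator {0<..<t} \<tau> * (Z \<tau> * heat_semigroup (t - \<tau>) w x))"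
  proof (rule integral_dominated_convergence)
    show "integrable lborel (\<lambda>\<tau>. B * \<bar>Z \<tau>\<bar>)"
      using iz by (intro integrable_mult_right integrable_abs)
    show "AE \<tau> in lborel. (\<lambda>n. indicator {0<..<T n} \<tau> * (Z \<tau> * heat_semigroup (T n - \<tau>) w (X n)))
      \<longlonglongrightarrow> indicator {0<..<t} \<tau> * (Z \<tau> * heat_semigroup (t - \<tau>) w x)"
      using AE_lborel_singleton[of t]
    proof eventually_elim
      fix \<tau> assume "\<tau> \<noteq> t"
      then show "(\<lambda>n. indicator {0<..<T n} \<tau> * (Z \<tau> * heat_semigroup (T n - \<tau>) w (X n)))
        \<longlonglongrightarrow> indicator {0<..<t} \<tau> * (Z \<tau> * heat_semigroup (t - \<tau>) w x)"
        unfolding eq'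
        by (intro tendsto_mult tendsto_const tendsto_indicator_Ioo T tendsto_heat_unit_kernel[OF w_bcontfun] X tendsto_diff)
    qed
    show "AE \<tau> in lborel. norm (indicator {0<..<T n} \<tau> * (Z \<tau> * heat_semigroup (T n - \<tau>) w (X n))) \<le> B * \<bar>Z \<tau>\<bar>" for n
    proof (rule AE_I2)
      fix \<tau>
      have B0: "0 \<le> B" using B[of 0] by linarith
      have "\<bar>Z \<tau>\<bar> * \<bar>heat_semigroup (T n - \<tau>) w (X n)\<bar> \<le> \<bar>Z \<tau>\<bar> * B" if "\<tau> < T n"
        using that by (intro mult_left_mono heat_semigroup_abs_le[OF w_borel B]) auto
      then show "norm (indicator {0<..<T n} \<tau> * (Z \<tau> * heat_semigroup (T n - \<tau>) w (X n))) \<le> B * \<bar>Z \<tau>\<bar>"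
        using B0 by (auto simp: indicator_def abs_mult mult.commute)
    qed
  qed measurable
  moreover have "forcing \<zeta> w s x = (LINT \<tau>|lborel. indicator {0<..<s} \<tau> * (Z \<tau> * heat_semigroup (s - \<tau>) w x))"
    if "s < M + 1" for s x
    by (simp only: forcing_def set_lebesgue_integral_def eq[OF that])
  moreover have "t < M + 1" using tM by linarith
  ultimately show ?thesis
    using TM by simp
qed

lemma forcing_restart:
  assumes z: "\<And>T. set_integrable lborel {0<..<T} \<zeta>" and r: "0 \<le> r" and s: "0 < s"
  shows "forcing \<zeta> w (r + s) x = heat_semigroup s (forcing \<zeta> w r) x + forcing (\<lambda>\<tau>. \<zeta> (r + \<tau>)) w s x"
proof -
  define Z where "Z \<tau> = indicator {0<..<r} \<tau> * \<zeta> \<tau>" for \<tau>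
  have iz: "integrable lborel Z"
    using z[of r] by (simp add: set_integrable_def Z_def[abs_def])
  then have zm [measurable]: "Z \<in> borel_measurable borel"
    by (auto dest: borel_measurable_integrable)
  have Z: "Z \<tau> = \<zeta> \<tau>" if "\<tau> \<in> {0<..<r}" for \<tau> using that by (simp add: Z_def)
  have "forcing \<zeta> w (r + s) x = (LBINT \<tau>:{0<..<r}. heat_semigroup (r + s - \<tau>) (\<lambda>y. \<zeta> \<tau> * w y) x)
     + (LBINT \<tau>:{0<..<s}. heat_semigroup (r + s - (r + \<tau>)) (\<lambda>y. \<zeta> (r + \<tau>) * w y) x)"
    unfolding forcing_def using forcing_set_integrable(1)[OF z, of "r + s" x] r s
    by (intro set_integral_Ioo_split) auto
  also have "(LBINT \<tau>:{0<..<r}. heat_semigroup (r + s - \<tau>) (\<lambda>y. \<zeta> \<tau> * w y) x)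
    = (LBINT \<tau>:{0<..<r}. heat_semigroup (s + r - \<tau>) (\<lambda>y. Z \<tau> * w y) x)"
    by (rule set_lebesgue_integral_cong) (auto simp: Z add.commute)
  also have "\<dots> = heat_semigroup s (\<lambda>z. LBINT \<tau>:{0<..<r}. heat_semigroup (r - \<tau>) (\<lambda>y. Z \<tau> * w y) z) x"
  proof (rule heat_semigroup_duhamel[symmetric, OF _ s])
    have "(\<lambda>(\<tau>, y). Z \<tau> * w y) \<in> borel_measurable (borel \<Otimes>\<^sub>M borel)" by measurable
    then show "(\<lambda>(\<tau>, y). Z \<tau> * w y) \<in> borel_measurable borel" by (simp add: borel_prod)
    have Zw: "\<bar>Z \<tau> * w y\<bar> \<le> \<bar>Z \<tau>\<bar> * B" for \<tau> y
      using mult_left_mono[OF B[of y], of "\<bar>Z \<tau>\<bar>"] by (simp add: abs_mult)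
    show "integrable lborel (\<lambda>y. heat_kernel (r - \<tau>) (z - y) * (Z \<tau> * w y))" if "\<tau> \<in> {0<..<r}" for \<tau> z
      using that by (intro heat_kernel_integrable_bounded[OF _ Zw]) auto
    show "(LINT y|lborel. heat_kernel (r - \<tau>) (z - y) * \<bar>Z \<tau> * w y\<bar>) \<le> \<bar>Z \<tau>\<bar> * B" if "\<tau> \<in> {0<..<r}" for \<tau> z
      using heat_semigroup_abs_le[of "\<lambda>y. \<bar>Z \<tau> * w y\<bar>" "\<bar>Z \<tau>\<bar> * B" "r - \<tau>" z] Zw that
      by (simp add: heat_semigroup_pos)
    have "integrable lborel (\<lambda>\<tau>. \<bar>Z \<tau>\<bar> * B)"
      using iz by (intro integrable_mult_left integrable_abs)
    then show "set_integrable lborel {0<..<r} (\<lambda>\<tau>. \<bar>Z \<tau>\<bar> * B)"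
      unfolding set_integrable_def by (rule integrable_mult_indicator[rotated]) simp
  qed
  also have "(\<lambda>z. LBINT \<tau>:{0<..<r}. heat_semigroup (r - \<tau>) (\<lambda>y. Z \<tau> * w y) z) = forcing \<zeta> w r"
    unfolding forcing_def[abs_def] by (intro ext set_lebesgue_integral_cong) (auto simp: Z)
  finally show ?thesis
    by (simp add: forcing_def[of _ _ s])
qed

end

section \<open>Local Lipschitz bound and continuity of the power nonlinearity\<close>

lemma powr_diff_le:
  fixes a b p R :: real
  assumes p: "1 < p" and "0 \<le> a" "a \<le> R" "0 \<le> b" "b \<le> R"
  shows "\<bar>a powr p - b powr p\<bar> \<le> p * R powr (p - 1) * \<bar>a - b\<bar>"
  using assms(2-)
proof (induction a b rule: linorder_wlog)
  case (le a b)
  show ?case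
  proof (cases "a = b")
    case False
    then have ab: "a < b" using le by simp
    \<comment> \<open>The mean value theorem asks for a derivative only in the open interval, which
      admits \<open>a = 0\<close>. As p > 1, the derivative increases and is at most its value at
      \<open>R\<close>.\<close>
    have "\<exists>l z. a < z \<and> z < b \<and> DERIV (\<lambda>x. x powr p) z :> l \<and> b powr p - a powr p = (b - a) * l"
    proof (rule MVT[OF ab])
      show "continuous_on {a..b} (\<lambda>x. x powr p)"
        using p le by (intro continuous_on_powr') (auto intro: continuous_intros)
      show "(\<lambda>x. x powr p) differentiable at x" if "a < x" for x
        using has_real_derivative_powr[of x p] that le by (auto simp: real_differentiable_def)
    qed
    then obtain l z where z: "a < z" "z < b" "DERIV (\<lambda>x. x powr p) z :> l" "b powr p - a powr p = (b - a) * l"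
      by blast
    have "l = p * z powr (p - 1)"
      using z le by (intro DERIV_unique[OF z(3)] has_real_derivative_powr) auto
    also have "\<dots> \<le> p * R powr (p - 1)"
      using z le p by (intro mult_left_mono powr_mono2) auto
    finally have "(b - a) * l \<le> (b - a) * (p * R powr (p - 1))"
      using ab by (intro mult_left_mono) auto
    moreover have "0 \<le> b powr p - a powr p"
      using le p by (simp add: powr_mono2)
    ultimately show ?thesis
      using z(4) ab by (simp add: abs_minus_commute mult.commute)
  qed simp
next
  case (sym a b)
  then show ?case by (simp add: abs_minus_commute)
qed

lemma joint_cb_powr:
  assumes g: "joint_cb B g" and p: "0 < p"
  shows "joint_cb (B powr p) (\<lambda>t x. \<bar>g t x\<bar> powr p)"
  unfolding joint_cb_def
proof (intro conjI allI)
  show "continuous_on UNIV (\<lambda>(t, x). \<bar>g t x\<bar> powr p)"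
    using g p unfolding joint_cb_def case_prod_beta
    by (intro continuous_on_powr' continuous_intros) auto
  show "\<bar>\<bar>g t x\<bar> powr p\<bar> \<le> B powr p" for t x
    using joint_cb_bound[OF g, of t x] p by (simp add: powr_mono2)
qed

section \<open>Local existence, uniqueness and continuation\<close>

lemma joint_cb_continuous_slice:
  assumes "joint_cb B g"
  shows "continuous_on UNIV (g t)"
proof -
  have "continuous_on UNIV ((\<lambda>(t, x). g t x) \<circ> Pair t)"
    using assms unfolding joint_cb_def
    by (intro continuous_on_compose continuous_intros) (auto intro: continuous_on_subset)
  then show ?thesis by (simp add: o_def)
qed

text \<open>
  Composition with \<open>clamp_time T\<close> extends a function on \<open>[0, T]\<close> to the whole line, as required
  by \<open>joint_cb\<close>, without affecting the Duhamel integrals up to time \<open>T\<close>.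
\<close>
definition clamp_time :: "real \<Rightarrow> real \<Rightarrow> real" where
  "clamp_time T t = max 0 (min T t)"

lemma clamp_time:
  "0 \<le> t \<Longrightarrow> t \<le> T \<Longrightarrow> clamp_time T t = t"
  "0 \<le> T \<Longrightarrow> 0 \<le> clamp_time T t"
  "0 \<le> T \<Longrightarrow> clamp_time T t \<le> T"
  by (auto simp: clamp_time_def)

lemma continuous_clamp_time: "continuous_on A (clamp_time T)"
  unfolding clamp_time_def[abs_def] by (intro continuous_intros)

lemma joint_cb_clamp_time:
  fixes u :: "real \<Rightarrow> 'a :: topological_space \<Rightarrow> real"
  assumes T: "0 \<le> T" and c: "continuous_on ({0..T} \<times> UNIV) (\<lambda>(t, x). u t x)"
    and B: "\<And>t x. 0 \<le> t \<Longrightarrow> t \<le> T \<Longrightarrow> \<bar>u t x\<bar> \<le> B"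
  shows "joint_cb B (\<lambda>t. u (clamp_time T t))"
  unfolding joint_cb_def
proof (intro conjI allI)
  have "continuous_on UNIV ((\<lambda>(t, x). u t x) \<circ> (\<lambda>q. (clamp_time T (fst q), snd q)))"
    using T
    by (intro continuous_on_compose continuous_intros continuous_on_compose2[OF continuous_clamp_time[of UNIV]] continuous_on_subset[OF c])
      (auto simp: clamp_time)
  then show "continuous_on UNIV (\<lambda>(t, x). u (clamp_time T t) x)" by (simp add: case_prod_beta o_def)
  show "\<bar>u (clamp_time T t) x\<bar> \<le> B" for t x
    using T by (intro B) (auto simp: clamp_time)
qed

locale fujita = heat_weight W C k
  for W :: "real ^ 'n \<Rightarrow> real" and C k :: real +
  fixes p :: real and w :: "real ^ 'n \<Rightarrow> real" and Bw :: real
  assumes p: "1 < p" and w: "continuous_on UNIV w" and Bw: "\<And>x. \<bar>w x\<bar> \<le> Bw"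
begin

text \<open>Forcing and initial value are arguments because a restart changes both of them, whereas
  weight, power and \<open>w\<close> stay fixed.\<close>

definition mild_rhs :: "(real \<Rightarrow> real) \<Rightarrow> (real ^ 'n \<Rightarrow> real) \<Rightarrow> (real \<Rightarrow> real ^ 'n \<Rightarrow> real) \<Rightarrow> real \<Rightarrow> real ^ 'n \<Rightarrow> real" where
  "mild_rhs \<zeta> a u t x = heat_semigroup t a x + duhamel (\<lambda>\<tau> y. \<bar>u \<tau> y\<bar> powr p) t x + forcing \<zeta> w t x"

text \<open>The time interval is closed, so that the value at its right end can serve as the initial
  value of the next piece.\<close>

definition mild_on :: "(real \<Rightarrow> real) \<Rightarrow> (real ^ 'n \<Rightarrow> real) \<Rightarrow> real \<Rightarrow> (real \<Rightarrow> real ^ 'n \<Rightarrow> real) \<Rightarrow> bool" where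
  "mild_on \<zeta> a T u \<longleftrightarrow>
     continuous_on ({0..T} \<times> UNIV) (\<lambda>(t, x). u t x) \<and>
     bounded ((\<lambda>(t, x). u t x) ` ({0..T} \<times> UNIV)) \<and>
     (\<forall>t x. 0 \<le> t \<and> t \<le> T \<longrightarrow> u t x = mild_rhs \<zeta> a u t x)"

lemma mild_onD:
  assumes "mild_on \<zeta> a T u" "0 \<le> t" "t \<le> T"
  shows "u t x = mild_rhs \<zeta> a u t x"
  using assms by (simp add: mild_on_def)

lemma mild_rhs_cong:
  assumes "\<And>\<tau> y. 0 < \<tau> \<Longrightarrow> \<tau> < t \<Longrightarrow> u \<tau> y = v \<tau> y"
  shows "mild_rhs \<zeta> a u t x = mild_rhs \<zeta> a v t x"
  unfolding mild_rhs_def using assms by (auto intro!: duhamel_cong)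

lemma mild_rhs_0 [simp]: "mild_rhs \<zeta> a u 0 x = a x"
  by (simp add: mild_rhs_def duhamel_def forcing_def set_lebesgue_integral_def) (simp add: heat_semigroup_def)

lemma mild_on_cong:
  assumes u: "mild_on \<zeta> a T u" and eq: "\<And>t x. 0 \<le> t \<Longrightarrow> t \<le> T \<Longrightarrow> u t x = v t x"
  shows "mild_on \<zeta> a T v"
  unfolding mild_on_def
proof (intro conjI allI impI)
  show "continuous_on ({0..T} \<times> UNIV) (\<lambda>(t, x). v t x)"
    using u unfolding mild_on_def
    by (subst continuous_on_cong[OF refl, of _ _ "\<lambda>(t, x). u t x"]) (auto simp: eq)
  have "(\<lambda>(t, x). v t x) ` ({0..T} \<times> UNIV) = (\<lambda>(t, x). u t x) ` ({0..T} \<times> UNIV)"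
    by (intro image_cong) (auto simp: eq)
  then show "bounded ((\<lambda>(t, x). v t x) ` ({0..T} \<times> UNIV))"
    using u by (simp add: mild_on_def)
  fix t x assume t: "0 \<le> t \<and> t \<le> T"
  then show "v t x = mild_rhs \<zeta> a v t x"
    using mild_onD[OF u, of t x] mild_rhs_cong[of t u v \<zeta> a x] eq[of t x] eq by auto
qed

lemma mild_on_restrict:
  assumes u: "mild_on \<zeta> a T u" and "S \<le> T"
  shows "mild_on \<zeta> a S u"
  unfolding mild_on_def
proof (intro conjI allI impI)
  have sub: "{0..S} \<times> (UNIV :: (real ^ 'n) set) \<subseteq> {0..T} \<times> UNIV" using assms(2) by auto
  show "continuous_on ({0..S} \<times> UNIV) (\<lambda>(t, x). u t x)"
    using u sub unfolding mild_on_def by (meson continuous_on_subset)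
  show "bounded ((\<lambda>(t, x). u t x) ` ({0..S} \<times> UNIV))"
    using u sub unfolding mild_on_def by (meson bounded_subset image_mono)
qed (use mild_onD[OF u] assms(2) in auto)

lemma mild_on_clamp:
  assumes u: "mild_on \<zeta> a T u" and T: "0 \<le> T"
  obtains B where "joint_cb B (\<lambda>t. u (clamp_time T t))"
proof -
  have c: "continuous_on ({0..T} \<times> UNIV) (\<lambda>(t, x). u t x)" using u by (simp add: mild_on_def)
  obtain B where "\<And>q. q \<in> (\<lambda>(t, x). u t x) ` ({0..T} \<times> UNIV) \<Longrightarrow> norm q \<le> B"
    using u unfolding mild_on_def bounded_iff by blast
  then have "\<bar>u t x\<bar> \<le> B" if "0 \<le> t" "t \<le> T" for t x
    using that by force
  then show thesis using joint_cb_clamp_time[OF T c] that by blast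
qed

lemma mild_rhs_tendsto:
  assumes g: "joint_cb B g" and a: "a \<in> bcontfun" and z: "\<And>T. set_integrable lborel {0<..<T} \<zeta>"
    and T: "T \<longlonglongrightarrow> t" and X: "X \<longlonglongrightarrow> x" and T0: "\<And>n. 0 \<le> T n" "0 \<le> t"
  shows "(\<lambda>n. mild_rhs \<zeta> a g (T n) (X n)) \<longlonglongrightarrow> mild_rhs \<zeta> a g t x"
  unfolding mild_rhs_def
  by (intro tendsto_add heat_semigroup_tendsto[OF a X T T0] forcing_tendsto[OF w Bw z T X]
      duhamel_tendsto[OF joint_cb_powr[OF g] T X]) (use p in simp)

lemma mild_rhs_continuous:
  assumes g: "joint_cb B g" and a: "a \<in> bcontfun" and z: "\<And>T. set_integrable lborel {0<..<T} \<zeta>"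
  shows "continuous_on ({0..} \<times> UNIV) (\<lambda>(t, x). mild_rhs \<zeta> a g t x)"
proof (rule continuous_on_sequentiallyI)
  fix q :: "nat \<Rightarrow> real \<times> (real ^ 'n)" and l
  assume q: "\<forall>n. q n \<in> {0..} \<times> UNIV" "l \<in> {0..} \<times> UNIV" "q \<longlonglongrightarrow> l"
  have "(\<lambda>n. mild_rhs \<zeta> a g (fst (q n)) (snd (q n))) \<longlonglongrightarrow> mild_rhs \<zeta> a g (fst l) (snd l)"
    by (intro mild_rhs_tendsto[OF g a z] tendsto_fst tendsto_snd q(3))
      (use q in \<open>auto simp: mem_Times_iff\<close>)
  then show "(\<lambda>n. case q n of (t, x) \<Rightarrow> mild_rhs \<zeta> a g t x) \<longlonglongrightarrow> (case l of (t, x) \<Rightarrow> mild_rhs \<zeta> a g t x)"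
    by (simp add: case_prod_beta)
qed

text \<open>The case \<open>s = 0\<close> yields the contraction estimate; positive
  \<open>s\<close>, a time up to which the two functions agree, serves uniqueness.\<close>

lemma duhamel_powr_diff_le:
  assumes U: "joint_cb R U" and V: "joint_cb R V" and s: "0 \<le> s" "s \<le> t"
    and zero: "\<And>\<tau> y. 0 < \<tau> \<Longrightarrow> \<tau> < s \<Longrightarrow> U \<tau> y = V \<tau> y"
    and le: "\<And>\<tau> y. s \<le> \<tau> \<Longrightarrow> \<tau> < t \<Longrightarrow> \<bar>U \<tau> y - V \<tau> y\<bar> \<le> D"
  shows "\<bar>duhamel (\<lambda>\<tau> y. \<bar>U \<tau> y\<bar> powr p) t x - duhamel (\<lambda>\<tau> y. \<bar>V \<tau> y\<bar> powr p) t x\<bar>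
    \<le> (p * R powr (p - 1) * D) * C * ((t - s) powr (k + 1) / (k + 1))"
proof -
  have p0: "0 < p" using p by simp
  note U' = joint_cb_powr[OF U p0] and V' = joint_cb_powr[OF V p0]
  show ?thesis
  proof (subst duhamel_diff[OF U' V'])
    show "\<bar>duhamel (\<lambda>\<tau> y. \<bar>U \<tau> y\<bar> powr p - \<bar>V \<tau> y\<bar> powr p) t x\<bar>
      \<le> (p * R powr (p - 1) * D) * C * ((t - s) powr (k + 1) / (k + 1))"
    proof (rule duhamel_abs_le[OF joint_cb_diff[OF U' V'] s])
      fix \<tau> y assume \<tau>: "s \<le> \<tau>" "\<tau> < t"
      have "\<bar>\<bar>U \<tau> y\<bar> powr p - \<bar>V \<tau> y\<bar> powr p\<bar> \<le> p * R powr (p - 1) * \<bar>\<bar>U \<tau> y\<bar> - \<bar>V \<tau> y\<bar>\<bar>"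
        using joint_cb_bound[OF U] joint_cb_bound[OF V] by (intro powr_diff_le p) auto
      also have "\<dots> \<le> p * R powr (p - 1) * D"
        using le[OF \<tau>, of y] p by (intro mult_left_mono) auto
      finally show "\<bar>\<bar>U \<tau> y\<bar> powr p - \<bar>V \<tau> y\<bar> powr p\<bar> \<le> p * R powr (p - 1) * D" .
    qed (use zero in auto)
  qed (use s in simp)
qed

lemma short_time:
  assumes "0 \<le> L"
  shows "\<exists>h>0. h \<le> 1 \<and> (\<forall>t. 0 \<le> t \<and> t \<le> h \<longrightarrow> L * (t powr (k + 1) / (k + 1)) \<le> 1 / 2)"
proof -
  have k1: "0 < k + 1" using k_gt by simp
  have "((\<lambda>t. L * (t powr (k + 1) / (k + 1))) \<longlongrightarrow> L * (0 powr (k + 1) / (k + 1))) (at_right 0)"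
    using k1 by (intro tendsto_intros tendsto_powr') (auto intro: eventually_at_right_less[THEN eventually_mono])
  then have "\<forall>\<^sub>F t in at_right 0. L * (t powr (k + 1) / (k + 1)) < 1 / 2"
    by (rule order_tendstoD) simp
  moreover have "\<forall>\<^sub>F t in at_right (0::real). 0 < t \<and> t < 1"
    using eventually_at_right_real[of 0 1] by (auto elim: eventually_mono)
  ultimately have "\<forall>\<^sub>F t in at_right (0::real). 0 < t \<and> t < 1 \<and> L * (t powr (k + 1) / (k + 1)) < 1 / 2"
    by eventually_elim auto
  then obtain h where h: "0 < h" "h < 1" "L * (h powr (k + 1) / (k + 1)) < 1 / 2"
    using eventually_happens'[OF trivial_limit_at_right_real] by blast
  have "L * (t powr (k + 1) / (k + 1)) \<le> 1 / 2" if "0 \<le> t" "t \<le> h" for t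
  proof -
    have "L * (t powr (k + 1) / (k + 1)) \<le> L * (h powr (k + 1) / (k + 1))"
      using assms k1 that by (intro mult_left_mono divide_right_mono powr_mono2) auto
    then show ?thesis using h(3) by linarith
  qed
  then show ?thesis using h by (intro exI[of _ h]) auto
qed

text \<open>Time is cut into windows of a length \<open>h\<close> that depends only on a common
  bound \<open>R\<close>. Once the solutions agree up to the start of a window, the integral
  equation turns any bound \<open>D\<close> of their difference there into \<open>D / 2\<close>;
  iteration gives 0, and induction passes to the next window.\<close>

lemma mild_on_unique:
  assumes u: "mild_on \<zeta> a T u" and v: "mild_on \<zeta> a T v" and t: "0 \<le> t" "t \<le> T"
  shows "u t x = v t x"
proof -
  have T: "0 \<le> T" using t by simp
  obtain B1 where "joint_cb B1 (\<lambda>t. u (clamp_time T t))" using mild_on_clamp[OF u T] .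
  moreover obtain B2 where "joint_cb B2 (\<lambda>t. v (clamp_time T t))" using mild_on_clamp[OF v T] .
  ultimately obtain R where U: "joint_cb R (\<lambda>t. u (clamp_time T t))" and V: "joint_cb R (\<lambda>t. v (clamp_time T t))"
    using that[of "max B1 B2"] unfolding joint_cb_def by (meson max.cobounded1 max.cobounded2 order_trans)
  have R0: "0 \<le> R" using joint_cb_nonneg[OF U] .
  define L where "L = p * R powr (p - 1) * C"
  have "0 \<le> L" using p C_pos by (simp add: L_def)
  from short_time[OF this] obtain h where h: "0 < h"
    "\<And>t. 0 \<le> t \<Longrightarrow> t \<le> h \<Longrightarrow> L * (t powr (k + 1) / (k + 1)) \<le> 1 / 2"
    by blast
  have diff: "\<bar>u t x - v t x\<bar> \<le> D / 2"
    if D: "\<And>\<tau> y. 0 \<le> \<tau> \<Longrightarrow> \<tau> \<le> t \<Longrightarrow> \<bar>u \<tau> y - v \<tau> y\<bar> \<le> D" and s: "0 \<le> s" "s \<le> t" "t \<le> s + h" "t \<le> T"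
      and eq: "\<And>\<tau> y. 0 \<le> \<tau> \<Longrightarrow> \<tau> \<le> s \<Longrightarrow> u \<tau> y = v \<tau> y" for D s t x
  proof -
    have D0: "0 \<le> D" using D[of 0 0] s by (meson abs_ge_zero order_refl order_trans)
    have "\<bar>u t x - v t x\<bar> = \<bar>duhamel (\<lambda>\<tau> y. \<bar>u \<tau> y\<bar> powr p) t x - duhamel (\<lambda>\<tau> y. \<bar>v \<tau> y\<bar> powr p) t x\<bar>"
      using mild_onD[OF u, of t x] mild_onD[OF v, of t x] s by (simp add: mild_rhs_def)
    also have "\<dots> = \<bar>duhamel (\<lambda>\<tau> y. \<bar>u (clamp_time T \<tau>) y\<bar> powr p) t x - duhamel (\<lambda>\<tau> y. \<bar>v (clamp_time T \<tau>) y\<bar> powr p) t x\<bar>"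
      using s by (intro arg_cong[of _ _ abs] arg_cong2[of _ _ _ _ "(-)"] duhamel_cong) (auto simp: clamp_time)
    also have "\<dots> \<le> (p * R powr (p - 1) * D) * C * ((t - s) powr (k + 1) / (k + 1))"
      using s by (intro duhamel_powr_diff_le[OF U V]) (auto simp: clamp_time eq intro!: D)
    also have "\<dots> = D * (L * ((t - s) powr (k + 1) / (k + 1)))"
      by (simp add: L_def)
    also have "\<dots> \<le> D * (1 / 2)"
      using s D0 by (intro mult_left_mono h) auto
    finally show ?thesis by simp
  qed
  have main: "\<forall>t x. 0 \<le> t \<and> t \<le> T \<and> t \<le> n * h \<longrightarrow> u t x = v t x" for n :: nat
  proof (induction n)
    case 0
    show ?case
      using mild_onD[OF u, of 0] mild_onD[OF v, of 0] by auto
  next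
    case (Suc n)
    \<comment> \<open>The iteration starts from the trivial bound \<open>2 * R\<close>, as both
      solutions are bounded by \<open>R\<close>.\<close>
    have iter: "\<forall>t x. 0 \<le> t \<and> t \<le> T \<and> t \<le> Suc n * h \<longrightarrow> \<bar>u t x - v t x\<bar> \<le> 2 * R / 2 ^ j" for j :: nat
    proof (induction j)
      case 0
      show ?case
      proof (intro allI impI)
        fix t x assume "0 \<le> t \<and> t \<le> T \<and> t \<le> Suc n * h"
        then show "\<bar>u t x - v t x\<bar> \<le> 2 * R / 2 ^ 0"
          using joint_cb_bound[OF U, of t x] joint_cb_bound[OF V, of t x] by (simp add: clamp_time)
      qed
    next
      case (Suc j)
      show ?case
      proof (intro allI impI)
        fix t x assume t: "0 \<le> t \<and> t \<le> T \<and> t \<le> Suc n * h"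
        show "\<bar>u t x - v t x\<bar> \<le> 2 * R / 2 ^ Suc j"
        proof (cases "t \<le> n * h")
          case True
          then show ?thesis using \<open>\<forall>t x. 0 \<le> t \<and> t \<le> T \<and> t \<le> n * h \<longrightarrow> u t x = v t x\<close> t R0 by simp
        next
          case False
          have "\<bar>u t x - v t x\<bar> \<le> (2 * R / 2 ^ j) / 2"
          proof (rule diff[where s = "n * h"])
            show "\<bar>u \<tau> y - v \<tau> y\<bar> \<le> 2 * R / 2 ^ j" if "0 \<le> \<tau>" "\<tau> \<le> t" for \<tau> y
              using Suc.IH that t by auto
            show "u \<tau> y = v \<tau> y" if "0 \<le> \<tau>" "\<tau> \<le> n * h" for \<tau> y
              using \<open>\<forall>t x. 0 \<le> t \<and> t \<le> T \<and> t \<le> n * h \<longrightarrow> u t x = v t x\<close> that t False by auto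
          qed (use t False h in \<open>auto simp: algebra_simps\<close>)
          then show ?thesis by simp
        qed
      qed
    qed
    show ?case
    proof (intro allI impI)
      fix t x assume t: "0 \<le> t \<and> t \<le> T \<and> t \<le> Suc n * h"
      have "(\<lambda>j. 2 * R * (1 / 2) ^ j) \<longlonglongrightarrow> 2 * R * 0"
        by (intro tendsto_intros LIMSEQ_power_zero) simp
      then have "\<bar>u t x - v t x\<bar> \<le> 2 * R * 0"
        by (rule LIMSEQ_le_const) (use iter t in \<open>auto simp: power_one_over divide_simps\<close>)
      then show "u t x = v t x" by simp
    qed
  qed
  obtain n :: nat where "t \<le> n * h"
    using reals_Archimedean3[OF h(1)] by (meson less_imp_le)
  then show ?thesis using main[of n] t by blast
qed

text \<open>The order of quantifiers is the point: \<delta> is chosen from \<open>A\<close> and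
  \<open>Z\<close> before the data, so one \<delta> serves all restarts under common bounds. Since
  \<delta> is at most 1, the integral of |\<zeta>| over (0, 1) controls the forcing.\<close>

lemma local_existence:
  assumes A: "0 \<le> A" and Z: "0 \<le> Z"
  shows "\<exists>\<delta>>0. \<delta> \<le> 1 \<and> (\<forall>a \<zeta>. a \<in> bcontfun \<longrightarrow> (\<forall>x. \<bar>a x\<bar> \<le> A) \<longrightarrow>
     (\<forall>T. set_integrable lborel {0<..<T} \<zeta>) \<longrightarrow> (LBINT \<tau>:{0<..<1}. \<bar>\<zeta> \<tau>\<bar>) \<le> Z \<longrightarrow> (\<exists>v. mild_on \<zeta> a \<delta> v))"
proof -
  have Bw0: "0 \<le> Bw" using Bw[of 0] by linarith
  \<comment> \<open>The linear part is at most \<open>A + Bw * Z\<close>, the nonlinear part will be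
    at most 1/2, so the ball of radius \<open>R\<close> is mapped into itself; the surplus also
    makes \<open>R\<close> positive.\<close>
  define R where "R = A + Bw * Z + 1"
  have R: "0 < R" using A Z Bw0 by (simp add: R_def add_nonneg_pos)
  \<comment> \<open>The sum of the Lipschitz constant, needed for the contraction, and of
    \<open>R powr p\<close>, needed for the self-map: one smallness condition on time covers
    both.\<close>
  define L where "L = (p * R powr (p - 1) + R powr p) * C"
  have L: "0 \<le> L" using p C_pos by (simp add: L_def)
  from short_time[OF L] obtain \<delta> where \<delta>: "0 < \<delta>" "\<delta> \<le> 1"
    "\<And>t. 0 \<le> t \<Longrightarrow> t \<le> \<delta> \<Longrightarrow> L * (t powr (k + 1) / (k + 1)) \<le> 1 / 2"
    by blast
  have small: "q * C * (t powr (k + 1) / (k + 1)) \<le> 1 / 2" if "0 \<le> t" "t \<le> \<delta>" "q \<le> p * R powr (p - 1) + R powr p" for t q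
  proof -
    have "q * C * (t powr (k + 1) / (k + 1)) \<le> L * (t powr (k + 1) / (k + 1))"
      unfolding L_def using that C_pos k_gt by (intro mult_right_mono) auto
    also have "\<dots> \<le> 1 / 2" by (rule \<delta>(3)[OF that(1,2)])
    finally show ?thesis .
  qed
  have "\<exists>v. mild_on \<zeta> a \<delta> v" if a: "a \<in> bcontfun" and aA: "\<And>x. \<bar>a x\<bar> \<le> A"
    and z: "\<And>T. set_integrable lborel {0<..<T} \<zeta>" and zZ: "(LBINT \<tau>:{0<..<1}. \<bar>\<zeta> \<tau>\<bar>) \<le> Z" for a \<zeta>
  proof -
    let ?s = "clamp_time \<delta>"
    have s: "0 \<le> ?s t" "?s t \<le> \<delta>" for t using clamp_time(2,3)[of \<delta> t] \<delta> by auto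
    have am: "a \<in> borel_measurable borel"
      using a by (auto simp: bcontfun_def intro: borel_measurable_continuous_onI)
    have forc: "\<bar>forcing \<zeta> w t x\<bar> \<le> Bw * Z" if t: "0 \<le> t" "t \<le> \<delta>" for t x
    proof -
      have "(LBINT \<tau>:{0<..<t}. \<bar>\<zeta> \<tau>\<bar>) \<le> (LBINT \<tau>:{0<..<1}. \<bar>\<zeta> \<tau>\<bar>)"
        using set_integrable_abs[OF z[of t]] set_integrable_abs[OF z[of 1]] t \<delta>
        unfolding set_lebesgue_integral_def set_integrable_def
        by (intro integral_mono) (auto simp: indicator_def)
      then have "(LBINT \<tau>:{0<..<t}. \<bar>\<zeta> \<tau>\<bar>) \<le> Z" using zZ by linarith
      then show ?thesis
        using forcing_set_integrable(2)[OF w Bw z[of t], of x] mult_left_mono[OF _ Bw0] by (meson order_trans)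
    qed
    \<comment> \<open>The right-hand side is frozen outside [0, \<delta>], so the fixed point can be
      sought among bounded continuous functions on the whole space-time, a complete space already at
      hand.\<close>
    define \<Phi> :: "((real \<times> (real ^ 'n)) \<Rightarrow>\<^sub>C real) \<Rightarrow> real \<times> (real ^ 'n) \<Rightarrow> real"
      where "\<Phi> v q = mild_rhs \<zeta> a (\<lambda>\<tau> y. apply_bcontfun v (\<tau>, y)) (?s (fst q)) (snd q)" for v q
    have jcb: "joint_cb R (\<lambda>\<tau> y. apply_bcontfun v (\<tau>, y))" if "norm v \<le> R" for v :: "(real \<times> (real ^ 'n)) \<Rightarrow>\<^sub>C real"
      using order_trans[OF norm_bounded that] by (auto simp: joint_cb_def case_prod_eta)
    have \<Phi>_bound: "\<bar>\<Phi> v q\<bar> \<le> R" if v: "norm v \<le> R" for v q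
    proof -
      have "\<bar>duhamel (\<lambda>\<tau> y. \<bar>apply_bcontfun v (\<tau>, y)\<bar> powr p) (?s (fst q)) (snd q)\<bar> \<le> R powr p * C * ((?s (fst q) - 0) powr (k + 1) / (k + 1))"
        using s p joint_cb_bound[OF joint_cb_powr[OF jcb[OF v], of p]]
        by (intro duhamel_abs_le[OF joint_cb_powr[OF jcb[OF v], of p]]) auto
      also have "\<dots> \<le> 1 / 2"
        using p s by (intro small) auto
      finally show ?thesis
        using heat_semigroup_abs_le[OF am aA s(1), of "fst q" "snd q"] forc[OF s, of "fst q" "snd q"]
        unfolding \<Phi>_def mild_rhs_def R_def by linarith
    qed
    have \<Phi>_cont: "\<Phi> v \<in> bcontfun" if v: "norm v \<le> R" for v
    proof (rule bcontfun_normI)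
      have "continuous_on UNIV ((\<lambda>(t, x). mild_rhs \<zeta> a (\<lambda>\<tau> y. apply_bcontfun v (\<tau>, y)) t x) \<circ> (\<lambda>q. (?s (fst q), snd q)))"
        by (intro continuous_on_compose continuous_intros continuous_on_compose2[OF continuous_clamp_time[of UNIV]]
            continuous_on_subset[OF mild_rhs_continuous[OF jcb[OF v] a z]]) (use s in auto)
      then show "continuous_on UNIV (\<Phi> v)" by (simp add: o_def \<Phi>_def[abs_def])
      show "norm (\<Phi> v q) \<le> R" for q using \<Phi>_bound[OF v] by simp
    qed
    \<comment> \<open>Its values are known only on the ball of radius \<open>R\<close>, where \<Phi>
      has been shown bounded and continuous; the fixed point theorem looks at nothing else.\<close>
    define F where "F v = Bcontfun (\<Phi> v)" for v
    have F: "apply_bcontfun (F v) = \<Phi> v" if "norm v \<le> R" for v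
      unfolding F_def by (rule Bcontfun_inverse[OF \<Phi>_cont[OF that]])
    have "\<exists>!v. v \<in> cball 0 R \<and> F v = v"
    proof (rule Banach_fix[where c="1 / 2"])
      show "complete (cball (0 :: (real \<times> (real ^ 'n)) \<Rightarrow>\<^sub>C real) R)" by (simp add: complete_eq_closed)
      show "cball (0 :: (real \<times> (real ^ 'n)) \<Rightarrow>\<^sub>C real) R \<noteq> {}" using R by simp
      show "F ` cball 0 R \<subseteq> cball 0 R"
        using \<Phi>_bound F by (auto intro!: norm_bound)
      show "dist (F u) (F v) \<le> 1 / 2 * dist u v" if uv: "u \<in> cball 0 R" "v \<in> cball 0 R" for u v
      proof (rule dist_bound)
        fix q
        have u: "norm u \<le> R" and v: "norm v \<le> R" using uv by auto
        have "dist (apply_bcontfun (F u) q) (apply_bcontfun (F v) q) = \<bar>duhamel (\<lambda>\<tau> y. \<bar>apply_bcontfun u (\<tau>, y)\<bar> powr p) (?s (fst q)) (snd q) - duhamel (\<lambda>\<tau> y. \<bar>apply_bcontfun v (\<tau>, y)\<bar> powr p) (?s (fst q)) (snd q)\<bar>"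
          by (simp add: F u v \<Phi>_def mild_rhs_def dist_real_def)
        also have "\<dots> \<le> (p * R powr (p - 1) * dist u v) * C * ((?s (fst q) - 0) powr (k + 1) / (k + 1))"
          using s dist_bounded[of u _ v] by (intro duhamel_powr_diff_le[OF jcb[OF u] jcb[OF v]]) (auto simp: dist_real_def)
        also have "\<dots> = dist u v * (p * R powr (p - 1) * C * (?s (fst q) powr (k + 1) / (k + 1)))"
          by simp
        also have "\<dots> \<le> dist u v * (1 / 2)"
          by (intro mult_left_mono small s) auto
        finally show "dist (apply_bcontfun (F u) q) (apply_bcontfun (F v) q) \<le> 1 / 2 * dist u v" by simp
      qed
    qed auto
    then obtain v where v: "norm v \<le> R" "F v = v" by auto
    have "mild_on \<zeta> a \<delta> (\<lambda>t x. apply_bcontfun v (t, x))"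
      unfolding mild_on_def
    proof (intro conjI allI impI)
      show "continuous_on ({0..\<delta>} \<times> UNIV) (\<lambda>(t, x). apply_bcontfun v (t, x))" by (simp add: case_prod_eta)
      show "bounded ((\<lambda>(t, x). apply_bcontfun v (t, x)) ` ({0..\<delta>} \<times> UNIV))"
        by (intro bounded_subset[OF bounded_apply_bcontfun[of v]]) auto
      fix t x assume "0 \<le> t \<and> t \<le> \<delta>"
      then show "apply_bcontfun v (t, x) = mild_rhs \<zeta> a (\<lambda>t x. apply_bcontfun v (t, x)) t x"
        using fun_cong[OF F[OF v(1)], of "(t, x)"] v(2) by (simp add: \<Phi>_def clamp_time)
    qed
    then show ?thesis by blast
  qed
  then show ?thesis using \<delta>(1,2) by (intro exI[of _ \<delta>]) blast
qed

section \<open>Restarting and gluing solutions\<close>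

lemma heat_semigroup_add3:
  fixes \<phi> \<psi> \<theta> :: "real ^ 'n \<Rightarrow> real"
  assumes "\<phi> \<in> borel_measurable borel" "\<psi> \<in> borel_measurable borel" "\<theta> \<in> borel_measurable borel"
    and "\<And>x. \<bar>\<phi> x\<bar> \<le> K" "\<And>x. \<bar>\<psi> x\<bar> \<le> L" "\<And>x. \<bar>\<theta> x\<bar> \<le> M" and s: "0 < s"
  shows "heat_semigroup s (\<lambda>x. \<phi> x + \<psi> x + \<theta> x) x = heat_semigroup s \<phi> x + heat_semigroup s \<psi> x + heat_semigroup s \<theta> x"
  using heat_kernel_integrable_bounded[OF assms(1,4) s, of x] heat_kernel_integrable_bounded[OF assms(2,5) s, of x]
    heat_kernel_integrable_bounded[OF assms(3,6) s, of x] s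
  by (simp add: heat_semigroup_pos distrib_left)

text \<open>An identity for an arbitrary bounded continuous \<open>g\<close>, not only for
  solutions. Gluing depends on this: it applies the identity to a function that is not yet known to
  solve the equation beyond \<open>r\<close>.\<close>

lemma mild_rhs_restart:
  assumes g: "joint_cb B g" and a: "a \<in> bcontfun" and z: "\<And>T. set_integrable lborel {0<..<T} \<zeta>"
    and r: "0 \<le> r" and s: "0 < s"
  shows "mild_rhs \<zeta> a g (r + s) x = mild_rhs (\<lambda>\<tau>. \<zeta> (r + \<tau>)) (mild_rhs \<zeta> a g r) (\<lambda>\<tau>. g (r + \<tau>)) s x"
proof -
  obtain A where A: "0 \<le> A" "\<And>x. \<bar>a x\<bar> \<le> A" "continuous_on UNIV a" using bcontfunD[OF a] by blast
  have p0: "0 < p" using p by simp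
  have [measurable]: "a \<in> borel_measurable borel" by (rule borel_measurable_continuous_onI[OF A(3)])
  let ?g = "\<lambda>\<tau> y. \<bar>g \<tau> y\<bar> powr p"
  note g' = joint_cb_powr[OF g p0]
  have "heat_semigroup s (\<lambda>x. heat_semigroup r a x + duhamel ?g r x + forcing \<zeta> w r x) x
    = heat_semigroup s (\<lambda>x. heat_semigroup r a x) x + heat_semigroup s (duhamel ?g r) x + heat_semigroup s (forcing \<zeta> w r) x"
  proof (rule heat_semigroup_add3[OF _ _ _ _ _ _ s])
    show "(\<lambda>x. heat_semigroup r a x) \<in> borel_measurable borel" by measurable
    show "duhamel ?g r \<in> borel_measurable borel"
      by (intro borel_measurable_continuous_onI continuous_on_sequentiallyI duhamel_tendsto[OF g'] tendsto_const)
    show "forcing \<zeta> w r \<in> borel_measurable borel"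
      by (intro borel_measurable_continuous_onI continuous_on_sequentiallyI forcing_tendsto[OF w Bw z] tendsto_const)
    show "\<bar>heat_semigroup r a x\<bar> \<le> A" for x by (rule heat_semigroup_abs_le[OF _ A(2) r]) measurable
    show "\<bar>duhamel ?g r x\<bar> \<le> B powr p * C * ((r - 0) powr (k + 1) / (k + 1))" for x
      by (rule duhamel_abs_le[OF g']) (use r joint_cb_bound[OF g'] in auto)
    show "\<bar>forcing \<zeta> w r x\<bar> \<le> Bw * (LBINT \<tau>:{0<..<r}. \<bar>\<zeta> \<tau>\<bar>)" for x
      by (rule forcing_set_integrable(2)[OF w Bw z])
  qed
  moreover have "heat_semigroup s (\<lambda>x. heat_semigroup r a x) x = heat_semigroup (r + s) a x"
  proof (cases "r = 0")
    case True
    then show ?thesis by (simp add: heat_semigroup_def)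
  next
    case False
    then have r0: "0 < r" using r by simp
    show ?thesis
    proof (subst heat_semigroup_semigroup[OF _ s r0])
      show "integrable lborel (\<lambda>y. heat_kernel r (z - y) * a y)" for z
        by (rule heat_kernel_integrable_bounded[OF _ A(2) r0]) measurable
      show "(LINT y|lborel. heat_kernel r (z - y) * \<bar>a y\<bar>) \<le> A" for z
        using heat_semigroup_abs_le[of "\<lambda>y. \<bar>a y\<bar>" A r z] A(2) r0 by (simp add: heat_semigroup_pos)
    qed (simp_all add: add.commute)
  qed
  ultimately show ?thesis
    unfolding mild_rhs_def duhamel_restart[OF g' r s] forcing_restart[OF w Bw z r s]
    by simp
qed

text \<open>The restart identity read backwards: the right-hand side at time r + h equals the
  restarted one at h, and for the latter \<open>v\<close> satisfies the equation.\<close>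

lemma mild_on_glue:
  assumes u: "mild_on \<zeta> a r u" and v: "mild_on (\<lambda>\<tau>. \<zeta> (r + \<tau>)) (u r) s v"
    and a: "a \<in> bcontfun" and z: "\<And>T. set_integrable lborel {0<..<T} \<zeta>"
    and r: "0 \<le> r" and s: "0 < s"
  shows "mild_on \<zeta> a (r + s) (\<lambda>t. if t \<le> r then u t else v (t - r))"
proof -
  define y where "y t = (if t \<le> r then u t else v (t - r))" for t
  have v0: "v 0 x = u r x" for x using mild_onD[OF v, of 0 x] s by simp
  have yv: "y (r + t) = v t" if "0 \<le> t" for t
    using that v0 by (cases "t = 0") (auto simp: y_def)
  have cont: "continuous_on ({0..r + s} \<times> UNIV) (\<lambda>(t, x). y t x)"
  proof -
    \<comment> \<open>The two closed pieces overlap at time \<open>r\<close>, where they match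
      because \<open>v\<close> starts from \<open>u r\<close>.\<close>
    have "continuous_on (({0..r} \<times> UNIV) \<union> ({r..r + s} \<times> UNIV)) (\<lambda>q. if fst q \<le> r then u (fst q) (snd q) else v (fst q - r) (snd q))"
    proof (rule continuous_on_cases)
      show "continuous_on ({0..r} \<times> UNIV) (\<lambda>q. u (fst q) (snd q))"
        using u by (simp add: mild_on_def case_prod_beta)
      have "continuous_on ({r..r + s} \<times> UNIV) ((\<lambda>(t, x). v t x) \<circ> (\<lambda>q. (fst q - r, snd q)))"
        using v unfolding mild_on_def
        by (intro continuous_on_compose continuous_intros) (auto elim!: continuous_on_subset)
      then show "continuous_on ({r..r + s} \<times> UNIV) (\<lambda>q. v (fst q - r) (snd q))"
        by (simp add: o_def)
    qed (use v0 in \<open>auto intro!: closed_Times\<close>)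
    moreover have "{0..r + s} \<times> UNIV = ({0..r} \<times> UNIV) \<union> ({r..r + s} \<times> (UNIV :: (real ^ 'n) set))"
      using r s by auto
    ultimately show ?thesis
      by (simp add: y_def case_prod_beta if_distribR)
  qed
  have bdd: "bounded ((\<lambda>(t, x). y t x) ` ({0..r + s} \<times> UNIV))"
  proof (rule bounded_subset)
    show "bounded ((\<lambda>(t, x). u t x) ` ({0..r} \<times> UNIV) \<union> (\<lambda>(t, x). v t x) ` ({0..s} \<times> UNIV))"
      using u v by (simp add: mild_on_def)
    show "(\<lambda>(t, x). y t x) ` ({0..r + s} \<times> UNIV) \<subseteq> (\<lambda>(t, x). u t x) ` ({0..r} \<times> UNIV) \<union> (\<lambda>(t, x). v t x) ` ({0..s} \<times> UNIV)"
    proof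
      fix q assume "q \<in> (\<lambda>(t, x). y t x) ` ({0..r + s} \<times> UNIV)"
      then obtain t x where t: "0 \<le> t" "t \<le> r + s" "q = y t x" by auto
      show "q \<in> (\<lambda>(t, x). u t x) ` ({0..r} \<times> UNIV) \<union> (\<lambda>(t, x). v t x) ` ({0..s} \<times> UNIV)"
      proof (cases "t \<le> r")
        case True
        then show ?thesis using t by (intro UnI1 image_eqI[of _ _ "(t, x)"]) (auto simp: y_def)
      next
        case False
        then show ?thesis using t by (intro UnI2 image_eqI[of _ _ "(t - r, x)"]) (auto simp: y_def)
      qed
    qed
  qed
  have rs: "0 \<le> r + s" using r s by simp
  obtain M where M: "\<And>q. q \<in> (\<lambda>(t, x). y t x) ` ({0..r + s} \<times> UNIV) \<Longrightarrow> norm q \<le> M"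
    using bdd unfolding bounded_iff by blast
  have "\<bar>y t x\<bar> \<le> M" if "0 \<le> t" "t \<le> r + s" for t x
    using M[of "y t x"] that by force
  then have J: "joint_cb M (\<lambda>t. y (clamp_time (r + s) t))"
    by (rule joint_cb_clamp_time[OF rs cont])
  \<comment> \<open>Up to \<open>r\<close> the glued function is \<open>u\<close>, so its right-hand
    side at time \<open>r\<close> is \<open>u r\<close>, exactly the initial value from which
    \<open>v\<close> starts.\<close>
  have ur: "mild_rhs \<zeta> a (\<lambda>t. y (clamp_time (r + s) t)) t x = u t x" if "0 \<le> t" "t \<le> r" for t x
    using mild_onD[OF u that, of x] that s
    by (subst mild_rhs_cong[of _ _ u]) (auto simp: y_def clamp_time)
  have "y t x = mild_rhs \<zeta> a y t x" if t: "0 \<le> t" "t \<le> r + s" for t x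
  proof -
    have "mild_rhs \<zeta> a y t x = mild_rhs \<zeta> a (\<lambda>t. y (clamp_time (r + s) t)) t x"
      using t by (intro mild_rhs_cong) (simp add: clamp_time)
    also have "\<dots> = y t x"
    proof (cases "t \<le> r")
      case True
      then show ?thesis using ur t by (simp add: y_def)
    next
      case False
      define h where "h = t - r"
      have h: "0 < h" "h \<le> s" "t = r + h" using False t by (auto simp: h_def)
      have "mild_rhs \<zeta> a (\<lambda>t. y (clamp_time (r + s) t)) t x
        = mild_rhs (\<lambda>\<tau>. \<zeta> (r + \<tau>)) (mild_rhs \<zeta> a (\<lambda>t. y (clamp_time (r + s) t)) r) (\<lambda>\<tau>. y (clamp_time (r + s) (r + \<tau>))) h x"
        unfolding h(3) by (rule mild_rhs_restart[OF J a z r h(1)])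
      also have "mild_rhs \<zeta> a (\<lambda>t. y (clamp_time (r + s) t)) r = u r"
        using ur[of r] r by auto
      also have "mild_rhs (\<lambda>\<tau>. \<zeta> (r + \<tau>)) (u r) (\<lambda>\<tau>. y (clamp_time (r + s) (r + \<tau>))) h x = mild_rhs (\<lambda>\<tau>. \<zeta> (r + \<tau>)) (u r) v h x"
        using h r by (intro mild_rhs_cong) (simp add: clamp_time yv)
      also have "\<dots> = v h x" using mild_onD[OF v, of h x] h by simp
      finally show ?thesis using h yv[of h] by simp
    qed
    finally show ?thesis by simp
  qed
  then have "mild_on \<zeta> a (r + s) y"
    using cont bdd by (simp add: mild_on_def)
  then show ?thesis by (simp add: y_def[abs_def])
qed

end

section \<open>The maximal solution\<close>

context fujita
begin

lemma shift_set_integrable: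
  assumes z: "\<And>T. set_integrable lborel {0<..<T} (\<zeta> :: real \<Rightarrow> real)" and r: "0 \<le> r"
  shows "set_integrable lborel {0<..<T} (\<lambda>\<tau>. \<zeta> (r + \<tau>))"
proof -
  have "set_integrable lborel {r<..<r + T} \<zeta>"
    using z[of "r + T"] by (rule set_integrable_subset) (use r in auto)
  then have "integrable lborel (\<lambda>\<tau>. indicator {r<..<r + T} (r + 1 * \<tau>) *\<^sub>R \<zeta> (r + 1 * \<tau>))"
    unfolding set_integrable_def by (rule lborel_integrable_real_affine) simp
  then show ?thesis
    unfolding set_integrable_def
    by (rule Bochner_Integration.integrable_cong[THEN iffD1, rotated -1]) (auto simp: indicator_def)
qed

lemma maximal_time_solution:
  assumes a: "a \<in> bcontfun" and z: "\<And>T. set_integrable lborel {0<..<T} \<zeta>"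
  shows "\<exists>(Tmax :: ereal) u. 0 < Tmax \<and> (\<forall>T. 0 < T \<and> ereal T < Tmax \<longrightarrow> mild_on \<zeta> a T u) \<and>
    (\<forall>T v. 0 < T \<and> mild_on \<zeta> a T v \<longrightarrow> ereal T \<le> Tmax) \<and>
    (Tmax < \<infinity> \<longrightarrow> filterlim (\<lambda>t. SUP x. \<bar>u t x\<bar>) at_top (at_left (real_of_ereal Tmax)))"
proof -
  let ?S = "{ereal T | T. 0 < T \<and> (\<exists>v. mild_on \<zeta> a T v)}"
  define Tmax where "Tmax = Sup ?S"
  \<comment> \<open>For each time a solution living at least that long is chosen and evaluated
    there; uniqueness makes the value independent of the choice.\<close>
  define u where "u t = (SOME v. \<exists>T>0. t \<le> T \<and> mild_on \<zeta> a T v) t" for t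
  obtain A where A: "0 \<le> A" "\<And>x. \<bar>a x\<bar> \<le> A" using bcontfunD[OF a] by blast
  have Z0: "0 \<le> (LBINT \<tau>:{0<..<T}. \<bar>\<zeta> \<tau>\<bar>)" for T
    unfolding set_lebesgue_integral_def by (intro integral_nonneg_AE) auto
  have upper: "ereal T \<le> Tmax" if "0 < T" "mild_on \<zeta> a T v" for T v
    unfolding Tmax_def using that by (intro Sup_upper) auto
  from local_existence[OF A(1) Z0[of 1]] a A(2) z obtain d v where d: "0 < d" "mild_on \<zeta> a d v"
    by blast
  have Tmax0: "0 < Tmax"
    using upper[OF d] d(1) by (meson ereal_less(2) less_le_trans)
  have u_eq: "u t x = v t x" if v: "mild_on \<zeta> a T v" and t: "0 \<le> t" "t \<le> T" "0 < T" for T v t x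
  proof -
    let ?P = "\<lambda>v. \<exists>T>0. t \<le> T \<and> mild_on \<zeta> a T v"
    have "?P (SOME v. ?P v)" by (rule someI[of ?P v]) (use that in blast)
    then obtain T' where T': "t \<le> T'" "mild_on \<zeta> a T' (SOME v. ?P v)" by blast
    have "mild_on \<zeta> a t (SOME v. ?P v)" "mild_on \<zeta> a t v"
      using mild_on_restrict[OF T'(2,1)] mild_on_restrict[OF v t(2)] by auto
    from mild_on_unique[OF this, of t x] show ?thesis
      using t by (simp add: u_def)
  qed
  have mild: "mild_on \<zeta> a T u" if T: "0 < T" "ereal T < Tmax" for T
  proof -
    from T(2) obtain T' v where v: "T < T'" "mild_on \<zeta> a T' v"
      \<comment> \<open>The supremum need not be attained, so a longer existence time strictly
        beyond \<open>T\<close> is picked and then restricted.\<close>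
      unfolding Tmax_def less_Sup_iff by auto
    then have "mild_on \<zeta> a T v" by (intro mild_on_restrict[OF v(2)]) simp
    then show ?thesis
      by (rule mild_on_cong) (use u_eq[OF v(2)] v(1) T in auto)
  qed
  have blow: "filterlim (\<lambda>t. SUP x. \<bar>u t x\<bar>) at_top (at_left (real_of_ereal Tmax))" if fin: "Tmax < \<infinity>"
  proof -
    obtain Tr where Tr: "Tmax = ereal Tr" "0 < Tr"
      using fin Tmax0 by (cases Tmax) auto
    show ?thesis
      unfolding filterlim_at_top Tr real_of_ereal.simps
    proof (intro allI, rule ccontr)
      fix K :: real
      assume neg: "\<not> (\<forall>\<^sub>F t in at_left Tr. K \<le> (SUP x. \<bar>u t x\<bar>))"
      \<comment> \<open>For r < Tr the translate of \<open>\<zeta>\<close> on (0, 1) is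
        \<open>\<zeta>\<close> on (r, r + 1), inside (0, Tr + 1). Thus \<open>?Z\<close> bounds the
        forcing after every restart before \<open>Tr\<close>.\<close>
      let ?Z = "LBINT \<tau>:{0<..<Tr + 1}. \<bar>\<zeta> \<tau>\<bar>"
      from local_existence[OF _ Z0[of "Tr + 1"], of "max 0 K"] obtain d where d: "0 < d"
        and ex: "\<And>b \<xi>. b \<in> bcontfun \<Longrightarrow> (\<And>x. \<bar>b x\<bar> \<le> max 0 K) \<Longrightarrow> (\<And>T. set_integrable lborel {0<..<T} \<xi>) \<Longrightarrow>
          (LBINT \<tau>:{0<..<1}. \<bar>\<xi> \<tau>\<bar>) \<le> ?Z \<Longrightarrow> \<exists>v. mild_on \<xi> b d v"
        by (metis max.cobounded1)
      \<comment> \<open>In this left neighbourhood a restart of length \<open>d\<close> necessarily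
        passes \<open>Tr\<close>.\<close>
      have "max 0 (Tr - d) < Tr" using Tr d by simp
      then have "\<forall>\<^sub>F t in at_left Tr. t \<in> {max 0 (Tr - d)<..<Tr}"
        by (rule eventually_at_left_real)
      note ev = this
      have "\<exists>r. r \<in> {max 0 (Tr - d)<..<Tr} \<and> \<not> K \<le> (SUP x. \<bar>u r x\<bar>)"
      proof (rule ccontr)
        assume "\<not> ?thesis"
        then have "\<forall>\<^sub>F t in at_left Tr. K \<le> (SUP x. \<bar>u t x\<bar>)"
          using ev by (auto elim: eventually_mono)
        with neg show False ..
      qed
      then obtain r where "r \<in> {max 0 (Tr - d)<..<Tr}" and K: "\<not> K \<le> (SUP x. \<bar>u r x\<bar>)"
        by (elim exE conjE)
      then have r: "0 < r" "Tr - d < r" "r < Tr" by auto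
      have ur: "mild_on \<zeta> a r u" using r Tr by (intro mild) auto
      obtain B where B: "joint_cb B (\<lambda>t. u (clamp_time r t))"
        using mild_on_clamp[OF ur] r by auto
      have cr: "clamp_time r r = r" using r by (simp add: clamp_time)
      \<comment> \<open>A real \<open>SUP\<close> controls the individual values only for a set
        bounded above, so boundedness comes before reading off a bound by \<open>K\<close>.\<close>
      have bdd: "bdd_above (range (\<lambda>x. \<bar>u r x\<bar>))"
        using joint_cb_bound[OF B, of r] cr by (intro bdd_aboveI[of _ B]) auto
      have bound: "\<bar>u r x\<bar> \<le> max 0 K" for x
        using cSUP_upper[OF UNIV_I bdd, of x] K by linarith
      have cont: "u r \<in> bcontfun"
        using joint_cb_continuous_slice[OF B, of r] bound cr by (intro bcontfun_normI[of _ "max 0 K"]) auto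
      have z': "set_integrable lborel {0<..<T} (\<lambda>\<tau>. \<zeta> (r + \<tau>))" for T
        using shift_set_integrable[OF z] r by simp
      have abs_int: "set_integrable lborel {0<..<T} (\<lambda>\<tau>. \<bar>\<zeta> \<tau>\<bar>)" for T
        by (rule set_integrable_abs[OF z])
      have "(LBINT \<tau>:{0<..<1}. \<bar>\<zeta> (r + \<tau>)\<bar>) \<le> (LBINT \<tau>:{0<..<r + 1}. \<bar>\<zeta> \<tau>\<bar>)"
        using set_integral_Ioo_split[OF abs_int, of r 1] Z0[of r] r by simp
      also have "\<dots> \<le> ?Z"
        using abs_int[of "r + 1"] abs_int[of "Tr + 1"] r
        unfolding set_lebesgue_integral_def set_integrable_def
        by (intro integral_mono) (auto simp: indicator_def)
      finally obtain v where v: "mild_on (\<lambda>\<tau>. \<zeta> (r + \<tau>)) (u r) d v"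
        using ex[OF cont bound z'] by blast
      have "mild_on \<zeta> a (r + d) (\<lambda>t. if t \<le> r then u t else v (t - r))"
        using r d by (intro mild_on_glue[OF ur v a z]) auto
      then have "ereal (r + d) \<le> Tmax" using r d by (intro upper) auto
      then show False using r Tr by simp
    qed
  qed
  show ?thesis using Tmax0 mild upper blow by (intro exI[of _ Tmax] exI[of _ u]) auto
qed

end

section \<open>From closed time intervals to the half-open intervals of the theorem\<close>

lemma mild_solution_iff:
  assumes "fujita W C k p w Bw" and W: "W = (\<lambda>y. norm y powr \<alpha>)"
  shows "mild_solution \<alpha> p \<zeta> w a Tmax u \<longleftrightarrow> 0 < Tmax \<and> (\<forall>T. 0 < T \<and> ereal T < Tmax \<longrightarrow> fujita.mild_on W p w \<zeta> a T u)"
proof -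
  interpret fujita W C k p w Bw by fact
  have rhs: "mild_rhs \<zeta> a u t x = heat_semigroup t a x
      + (LBINT \<tau>:{0<..<t}. heat_semigroup (t - \<tau>) (\<lambda>y. norm y powr \<alpha> * \<bar>u \<tau> y\<bar> powr p) x)
      + (LBINT \<tau>:{0<..<t}. heat_semigroup (t - \<tau>) (\<lambda>y. \<zeta> \<tau> * w y) x)" for t x
    unfolding mild_rhs_def duhamel_def forcing_def by (simp add: W)
  have time: "(\<forall>t. 0 \<le> t \<and> ereal t < Tmax \<longrightarrow> P t) \<longleftrightarrow> (\<forall>T. 0 < T \<and> ereal T < Tmax \<longrightarrow> (\<forall>t. 0 \<le> t \<and> t \<le> T \<longrightarrow> P t))"
    if "0 < Tmax" for P
  proof (intro iffI allI impI)
    fix T t assume "\<forall>t. 0 \<le> t \<and> ereal t < Tmax \<longrightarrow> P t" "0 < T \<and> ereal T < Tmax" "0 \<le> t \<and> t \<le> T"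
    then show "P t" by (meson ereal_less_eq(3) le_less_trans)
  next
    fix t assume *: "\<forall>T. 0 < T \<and> ereal T < Tmax \<longrightarrow> (\<forall>t. 0 \<le> t \<and> t \<le> T \<longrightarrow> P t)" "0 \<le> t \<and> ereal t < Tmax"
    \<comment> \<open>An intermediate time puts \<open>t\<close> into a closed interval on which the
      equation is known; being strictly larger than \<open>t\<close>, it is positive even for
      \<open>t = 0\<close>.\<close>
    obtain T where T: "ereal t < ereal T" "ereal T < Tmax"
      using ereal_dense2[of "ereal t" Tmax] *(2) by auto
    then have "0 < T" "t \<le> T" using *(2) by (auto simp: order_le_less_trans)
    then show "P t" using * T(2) by blast
  qed
  show ?thesis
  proof (cases "0 < Tmax")
    case True
    show ?thesis
      unfolding mild_solution_def mild_on_def rhs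
      using time[OF True, of "\<lambda>t. \<forall>x. u t x = heat_semigroup t a x
        + (LBINT \<tau>:{0<..<t}. heat_semigroup (t - \<tau>) (\<lambda>y. norm y powr \<alpha> * \<bar>u \<tau> y\<bar> powr p) x)
        + (LBINT \<tau>:{0<..<t}. heat_semigroup (t - \<tau>) (\<lambda>y. \<zeta> \<tau> * w y) x)"] True
      by auto
  qed (simp add: mild_solution_def)
qed

text \<open>Near 0 integrability is \<sigma> > -1; on \<open>{1..T}\<close> the power is continuous,
  whatever the sign of \<open>m\<close>.\<close>

lemma set_integrable_powr_glued:
  fixes \<zeta> :: "real \<Rightarrow> real"
  assumes \<sigma>: "- 1 < \<sigma>"
    and \<zeta>: "(\<forall>t>0. \<zeta> t = t powr \<sigma>) \<or> (\<forall>t>0. \<zeta> t = (if t < 1 then t powr \<sigma> else t powr m))"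
  shows "set_integrable lborel {0<..<T} \<zeta>"
  using \<zeta>
proof
  assume "\<forall>t>0. \<zeta> t = t powr \<sigma>"
  then have "set_integrable lborel {0<..<T} \<zeta> \<longleftrightarrow> set_integrable lborel {0<..<T} (\<lambda>t. t powr \<sigma>)"
    by (intro set_integrable_cong) auto
  then show ?thesis
    using set_integral_powr_Ioo(1)[OF \<sigma>, of T] by (cases "0 \<le> T") auto
next
  assume \<zeta>: "\<forall>t>0. \<zeta> t = (if t < 1 then t powr \<sigma> else t powr m)"
  then have "set_integrable lborel {0<..<1} \<zeta> \<longleftrightarrow> set_integrable lborel {0<..<1} (\<lambda>t. t powr \<sigma>)"
    by (intro set_integrable_cong) auto
  then have "set_integrable lborel {0<..<1} \<zeta>"
    using set_integral_powr_Ioo(1)[OF \<sigma>, of 1] by simp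
  moreover have "set_integrable lborel {1..T} \<zeta>"
  proof -
    have "set_integrable lborel {1..T} (\<lambda>t. t powr m)"
      unfolding set_integrable_def
      by (intro borel_integrable_compact) (auto intro!: continuous_intros)
    moreover have "set_integrable lborel {1..T} \<zeta> \<longleftrightarrow> set_integrable lborel {1..T} (\<lambda>t. t powr m)"
      using \<zeta> by (intro set_integrable_cong) auto
    ultimately show ?thesis by simp
  qed
  ultimately have "set_integrable lborel ({0<..<1} \<union> {1..T}) \<zeta>"
    by (rule set_integrable_Un) auto
  then show ?thesis
    by (rule set_integrable_subset) auto
qed

theorem theorem1p1:
  fixes \<alpha> p \<sigma> m :: real
    and \<zeta> :: "real \<Rightarrow> real"
    and w u0 :: "real ^ 'n \<Rightarrow> real"
  assumes "CARD('n) \<ge> 3"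
    and "- 2 < \<alpha>" and "\<alpha> \<le> 0"
    and "p > 1"
    and "\<sigma> > - 1"
    and "w \<in> bcontfun"
    and "(\<forall>t>0. \<zeta> t = t powr \<sigma>) \<or>
         (\<forall>t>0. \<zeta> t = (if t < 1 then t powr \<sigma> else t powr m))"
    and "u0 \<in> bcontfun"
  shows "\<exists>(Tmax :: ereal) u.
           0 < Tmax \<and>
           maximal_mild_solution \<alpha> p \<zeta> w u0 Tmax u \<and>
           (\<forall>T' v. maximal_mild_solution \<alpha> p \<zeta> w u0 T' v \<longrightarrow>
              T' = Tmax \<and> (\<forall>t x. 0 \<le> t \<and> ereal t < Tmax \<longrightarrow> v t x = u t x)) \<and>
           (Tmax < \<infinity> \<longrightarrow>
              filterlim (\<lambda>t. SUP x. \<bar>u t x\<bar>) at_top (at_left (real_of_ereal Tmax))) \<and>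
           ((\<forall>x. 0 \<le> u0 x) \<and> (\<forall>x. 0 \<le> w x) \<longrightarrow>
              (\<forall>t x. 0 \<le> t \<and> ereal t < Tmax \<longrightarrow> 0 \<le> u t x))"
proof -
  define W where "W = (\<lambda>y :: real ^ 'n. norm y powr \<alpha>)"
  obtain Bw where Bw: "\<And>x. \<bar>w x\<bar> \<le> Bw" "continuous_on UNIV w" using bcontfunD[OF assms(6)] by blast
  \<comment> \<open>Dimension at least 3 and \<alpha> > -2 give the local integrability of the
    weight.\<close>
  have "- real CARD('n) < \<alpha>" using assms(1,2) by linarith
  from heat_norm_powr_bound[OF assms(3) this] obtain C where C: "0 < C"
    "\<And>t x :: real ^ 'n. 0 < t \<Longrightarrow> integrable lborel (\<lambda>y. heat_kernel t (x - y) * norm y powr \<alpha>)"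
    "\<And>t x :: real ^ 'n. 0 < t \<Longrightarrow> (LINT y|lborel. heat_kernel t (x - y) * norm y powr \<alpha>) \<le> C * t powr (\<alpha> / 2)"
    by blast
  have fj: "fujita W C (\<alpha> / 2) p w Bw"
    by unfold_locales (use assms C Bw in \<open>auto simp: W_def\<close>)
  interpret fujita W C "\<alpha> / 2" p w Bw by (rule fj)
  have z: "set_integrable lborel {0<..<T} \<zeta>" for T
    by (rule set_integrable_powr_glued[OF assms(5,7)])
  note iff = mild_solution_iff[OF fj W_def]
  obtain Tmax u where T: "0 < Tmax"
    and mild: "\<And>T. 0 < T \<Longrightarrow> ereal T < Tmax \<Longrightarrow> mild_on \<zeta> u0 T u"
    and upper: "\<And>T v. 0 < T \<Longrightarrow> mild_on \<zeta> u0 T v \<Longrightarrow> ereal T \<le> Tmax"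
    and blow: "Tmax < \<infinity> \<Longrightarrow> filterlim (\<lambda>t. SUP x. \<bar>u t x\<bar>) at_top (at_left (real_of_ereal Tmax))"
    using maximal_time_solution[OF assms(8) z] by blast
  have sol: "mild_solution \<alpha> p \<zeta> w u0 Tmax u" using T mild by (simp add: iff)
  have le: "T' \<le> Tmax" if v: "mild_solution \<alpha> p \<zeta> w u0 T' v" for T' v
  proof (rule ccontr)
    assume "\<not> T' \<le> Tmax"
    then obtain T where "Tmax < ereal T" "ereal T < T'"
      using ereal_dense2[of Tmax T'] by (auto simp: not_le)
    moreover have "0 < T" using \<open>Tmax < ereal T\<close> T by (metis ereal_less(2) less_trans)
    ultimately show False using v upper[of T v] by (auto simp: iff)
  qed
  have agree: "v t x = u t x" if v: "mild_solution \<alpha> p \<zeta> w u0 T' v" and t: "0 \<le> t" "ereal t < T'" for T' v t x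
  proof -
    obtain T where T: "t < T" "ereal T < T'"
      using ereal_dense2[OF t(2)] by auto
    have "mild_on \<zeta> u0 T v" using v T t by (simp add: iff)
    moreover have "mild_on \<zeta> u0 T u" using mild[of T] le[OF v] T t by (auto intro: less_le_trans)
    ultimately show ?thesis using mild_on_unique T t by (meson less_imp_le)
  qed
  show ?thesis
  proof (intro exI[of _ Tmax] exI[of _ u] conjI allI impI)
    show "0 < Tmax" by fact
    show "maximal_mild_solution \<alpha> p \<zeta> w u0 Tmax u"
      unfolding maximal_mild_solution_def using sol le by (meson not_le)
    fix T' v assume v: "maximal_mild_solution \<alpha> p \<zeta> w u0 T' v"
    then have v': "mild_solution \<alpha> p \<zeta> w u0 T' v" by (simp add: maximal_mild_solution_def)
    \<comment> \<open>If \<open>T'\<close> were smaller, \<open>u\<close> would be a proper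
      extension of \<open>v\<close>, against the maximality of \<open>v\<close>.\<close>
    show eq: "T' = Tmax"
    proof (rule ccontr)
      assume "T' \<noteq> Tmax"
      then have "T' < Tmax" using le[OF v'] by simp
      then show False
        using v sol agree[OF v'] unfolding maximal_mild_solution_def by metis
    qed
    show "v t x = u t x" if "0 \<le> t \<and> ereal t < Tmax" for t x
      using agree[OF v'] that eq by simp
  next
    show "filterlim (\<lambda>t. SUP x. \<bar>u t x\<bar>) at_top (at_left (real_of_ereal Tmax))" if "Tmax < \<infinity>"
      by (rule blow[OF that])
  next
    fix t x
    assume pos: "(\<forall>x. 0 \<le> u0 x) \<and> (\<forall>x. 0 \<le> w x)" and t: "0 \<le> t \<and> ereal t < Tmax"
    have \<zeta>: "0 \<le> \<zeta> \<tau>" if "0 < \<tau>" for \<tau> using assms(7) that by auto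
    \<comment> \<open>The sign is read off the formula: \<open>\<bar>u \<tau> y\<bar> powr p\<close>
      is nonnegative whatever the sign of \<open>u\<close>, so no comparison argument
      enters.\<close>
    have "u t x = heat_semigroup t u0 x
      + (LBINT \<tau>:{0<..<t}. heat_semigroup (t - \<tau>) (\<lambda>y. norm y powr \<alpha> * \<bar>u \<tau> y\<bar> powr p) x)
      + (LBINT \<tau>:{0<..<t}. heat_semigroup (t - \<tau>) (\<lambda>y. \<zeta> \<tau> * w y) x)"
      using sol t by (simp add: mild_solution_def)
    moreover have "0 \<le> heat_semigroup t u0 x"
      using pos by (intro heat_semigroup_nonneg) auto
    moreover have "0 \<le> (LBINT \<tau>:{0<..<t}. heat_semigroup (t - \<tau>) (\<lambda>y. norm y powr \<alpha> * \<bar>u \<tau> y\<bar> powr p) x)"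
      unfolding set_lebesgue_integral_def
      by (intro integral_nonneg_AE AE_I2) (auto intro!: heat_semigroup_nonneg mult_nonneg_nonneg)
    moreover have "0 \<le> (LBINT \<tau>:{0<..<t}. heat_semigroup (t - \<tau>) (\<lambda>y. \<zeta> \<tau> * w y) x)"
      unfolding set_lebesgue_integral_def using pos \<zeta>
      by (intro integral_nonneg_AE AE_I2) (auto simp: indicator_def intro!: heat_semigroup_nonneg mult_nonneg_nonneg)
    ultimately show "0 \<le> u t x" by linarith
  qed
qed

end
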